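(* There is an absolute constant $C$ such that for every fixed integer $m\geq 2$ and all sufficiently large $n$ (depending on $m$), we have \[ N_{\mathcal{P}}(n,P_{2m+1})\leq C\, m^{-m}\, n^{m+1}\;. \]
   Context: For a fixed graph $H$, $N_{\mathcal{P}}(n,H)$ denotes the maximum number of (not necessarily induced) copies of $H$ in a planar graph on $n$ vertices. $P_k$ denotes the path with $k$ vertices (and $k-1$ edges). *)

theory Defs
  imports "HOL-Analysis.Analysis"
begin

type_synonym 'a ugraph = "'a set \<times> 'a set set"

abbreviation vertices :: "'a ugraph \<Rightarrow> 'a set" where
  "vertices \<equiv> fst"

abbreviation edges :: "'a ugraph \<Rightarrow> 'a set set" where
  "edges \<equiv> snd"

definition simple_graph :: "'a ugraph \<Rightarrow> bool" where
  "simple_graph G \<longleftrightarrow>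
     finite (vertices G) \<and> (\<forall>e\<in>edges G. e \<subseteq> vertices G \<and> card e = 2)"

definition subgraph_of :: "'a ugraph \<Rightarrow> 'a ugraph \<Rightarrow> bool" where
  "subgraph_of S G \<longleftrightarrow>
     simple_graph S \<and> vertices S \<subseteq> vertices G \<and> edges S \<subseteq> edges G"

definition isomorphic :: "'a ugraph \<Rightarrow> 'b ugraph \<Rightarrow> bool" where
  "isomorphic G H \<longleftrightarrow>
     (\<exists>f. bij_betw f (vertices G) (vertices H) \<and> edges H = (\<lambda>e. f ` e) ` edges G)"

text \<open>A drawing places the vertices at distinct points of the plane, which is represented by the
  type of complex numbers, and draws each edge as an arc (an injective path) joining its two
  endpoints; the interior of that arc contains no vertex and no point of any other edge.\<close>

definition plane_drawing :: "'a ugraph \<Rightarrow> ('a \<Rightarrow> complex) \<Rightarrow> ('a set \<Rightarrow> real \<Rightarrow> complex) \<Rightarrow> bool" where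
  "plane_drawing G p \<gamma> \<longleftrightarrow>
     inj_on p (vertices G) \<and>
     (\<forall>e\<in>edges G. arc (\<gamma> e) \<and> {pathstart (\<gamma> e), pathfinish (\<gamma> e)} = p ` e) \<and>
     (\<forall>e\<in>edges G. (path_image (\<gamma> e) - p ` e) \<inter> p ` vertices G = {}) \<and>
     (\<forall>e\<in>edges G. \<forall>e'\<in>edges G. e \<noteq> e' \<longrightarrow>
        (path_image (\<gamma> e) - p ` e) \<inter> path_image (\<gamma> e') = {})"

definition planar_graph :: "'a ugraph \<Rightarrow> bool" where
  "planar_graph G \<longleftrightarrow> simple_graph G \<and> (\<exists>p \<gamma>. plane_drawing G p \<gamma>)"

text \<open>Copies are subgraphs, so a copy is counted once and not once for each automorphism of
  \<open>H\<close>.\<close>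

definition num_copies :: "'b ugraph \<Rightarrow> 'a ugraph \<Rightarrow> nat" where
  "num_copies H G = card {S. subgraph_of S G \<and> isomorphic H S}"

text \<open>Every finite graph is isomorphic to one whose vertices are natural numbers. The maximum is
  taken over a finite nonempty set, see \<open>copy_counts_finite\<close> and
  \<open>copy_counts_nonempty\<close> below.\<close>

definition max_planar_copies :: "nat \<Rightarrow> 'b ugraph \<Rightarrow> nat" where
  "max_planar_copies n H =
     Max {num_copies H G | G :: nat ugraph. planar_graph G \<and> card (vertices G) = n}"

definition path_graph :: "nat \<Rightarrow> nat ugraph" where
  "path_graph k = ({..<k}, {{i, Suc i} | i. Suc i < k})"

lemma num_copies_le:
  fixes G :: "'a ugraph"
  assumes "simple_graph G"
  shows "num_copies H G \<le> 2 ^ card (vertices G) * 2 ^ (2 ^ card (vertices G))"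
proof -
  let ?V = "vertices G"
  have fin: "finite ?V" using assms by (simp add: simple_graph_def)
  have "edges G \<subseteq> Pow ?V" using assms by (auto simp: simple_graph_def)
  then have "{S. subgraph_of S G \<and> isomorphic H S} \<subseteq> Pow ?V \<times> Pow (Pow ?V)"
    by (auto simp: subgraph_of_def) blast
  then have "num_copies H G \<le> card (Pow ?V \<times> Pow (Pow ?V))"
    unfolding num_copies_def using fin by (intro card_mono) auto
  also have "\<dots> = 2 ^ card ?V * 2 ^ (2 ^ card ?V)"
    using fin by (simp add: card_cartesian_product card_Pow)
  finally show ?thesis .
qed

lemma copy_counts_finite:
  "finite {num_copies H G | G :: nat ugraph. planar_graph G \<and> card (vertices G) = n}"
  by (rule finite_subset[of _ "{..2 ^ n * 2 ^ (2 ^ n)}"])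
    (use num_copies_le in \<open>fastforce simp: planar_graph_def\<close>)+

lemma copy_counts_nonempty:
  "{num_copies H G | G :: nat ugraph. planar_graph G \<and> card (vertices G) = n} \<noteq> {}"
proof -
  have "plane_drawing ({..<n}, {}) of_nat \<gamma>" for \<gamma>
    by (simp add: plane_drawing_def inj_on_def)
  then have "planar_graph ({..<n}, {})" "card (vertices ({..<n}, {})) = n"
    by (auto simp: planar_graph_def simple_graph_def)
  then show ?thesis by blast
qed

end

theory Submission
  imports Defs
begin

text \<open>Planarity enters only through two consequences of the nonplanarity of \<open>K\<^sub>3\<^sub>,\<^sub>3\<close>: a planar graph has
  \<open>O(n)\<close> edges (Mader's theorem on subdivisions) and contains no \<open>K\<^sub>3\<^sub>,\<^sub>3\<close> as a subgraph.

  Call a vertex big if its degree exceeds \<open>n / q\<close>, where \<open>q\<close> depends on \<open>m\<close> only; there are \<open>O\<^sub>m(1)\<close> big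
  vertices. A path \<open>x\<^sub>0 \<dots> x\<^sub>2\<^sub>m\<close> with a small vertex at an odd position is determined by \<open>m\<close> edges and one
  neighbour of a small vertex, which gives at most \<open>O(n)\<^sup>m n / q\<close> paths. In the remaining paths the
  odd positions are big, and all but \<open>O\<^sub>m(n\<^sup>m)\<close> of these have at their even positions vertices with at
  most two big neighbours.

  The main term is thus a sum over paths \<open>v\<^sub>1 \<dots> v\<^sub>m\<close> of big vertices of
  \<open>d(v\<^sub>1) c(v\<^sub>1,v\<^sub>2) \<dots> c(v\<^sub>m\<^sub>-\<^sub>1,v\<^sub>m) d(v\<^sub>m)\<close>, where \<open>d\<close> and \<open>c\<close> count neighbours and common neighbours, and
  \<open>c\<close> has total weight at most \<open>n\<close>. Bounding \<open>d(v\<^sub>1) d(v\<^sub>m)\<close> by the mean of the squares reduces this to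
  paths with a fixed starting vertex \<open>y\<close> and weight \<open>d(y)\<^sup>2\<close>. Such a path never returns to \<open>y\<close>, so all but its
  first step live on weight \<open>n - d(y)\<close>, and the arithmetic-geometric mean inequality bounds the sum by
  \<open>d(y)\<^sup>3 ((n - d(y)) / (m - 2))\<^sup>m\<^sup>-\<^sup>2 \<le> 4 d(y) (n / m)\<^sup>m\<close>. Finally \<open>\<Sum> d(y) \<le> 2 n\<close>.\<close>

section \<open>Nonplanarity of \<open>K\<^sub>3\<^sub>,\<^sub>3\<close>\<close>

text \<open>Deleting a point from an open connected set in the plane leaves it connected, so the
  point \<open>c\<close>, where \<open>g\<close> may be discontinuous, can be cut out of the
  component. The use is for inversions, made total by \<open>inverse 0 = 0\<close>.\<close>

lemma connected_component_injective_image: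
  fixes g :: "complex \<Rightarrow> complex"
  assumes conn: "connected_component (- S) x y" and "closed S" and xy: "x \<noteq> c" "y \<noteq> c"
    and "inj g" and cont: "continuous_on (- {c}) g"
  shows "connected_component (- (g ` S)) (g x) (g y)"
proof -
  let ?U = "connected_component_set (- S) x"
  have "open ?U" using \<open>closed S\<close> by (simp add: open_connected_component open_Compl)
  then have "connected (?U - {c})"
    by (intro connected_open_delete) auto
  then have 1: "connected (g ` (?U - {c}))"
    by (intro connected_continuous_image continuous_on_subset[OF cont]) auto
  have 2: "g ` (?U - {c}) \<subseteq> - (g ` S)"
    using connected_component_subset[of "- S" x] \<open>inj g\<close> by (auto dest: injD)
  have "x \<in> ?U" using conn connected_component_in by fastforce
  with conn xy show ?thesis
    by (intro connected_componentI[OF 1 2]) auto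
qed

text \<open>The chord \<open>c3\<close> splits the inside of the Jordan curve formed by
  \<open>c1\<close> and \<open>c2\<close> in two. If \<open>z\<close> lies in the part bounded by
  \<open>c1\<close> and \<open>c3\<close>, its connection to \<open>q2\<close> avoids that boundary
  and puts \<open>q2\<close> inside the original curve, although \<open>q2\<close> lies on it. The
  other part is symmetric with \<open>q1\<close>.\<close>

lemma theta_inside_separation:
  fixes c1 c2 c3 :: "real \<Rightarrow> complex"
  assumes arcs: "arc c1" "arc c2" "arc c3"
    and ends: "pathstart c1 = a" "pathfinish c1 = b" "pathstart c2 = a" "pathfinish c2 = b"
      "pathstart c3 = a" "pathfinish c3 = b"
    and int: "path_image c1 \<inter> path_image c2 = {a, b}" "path_image c1 \<inter> path_image c3 = {a, b}"
      "path_image c2 \<inter> path_image c3 = {a, b}"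
    and z: "z \<in> inside (path_image c1 \<union> path_image c2)" "z \<notin> path_image c3"
    and q: "q1 \<in> path_image c1" "q2 \<in> path_image c2"
      "q3 \<in> path_image c3" "q3 \<in> inside (path_image c1 \<union> path_image c2)"
  shows "\<not> (connected_component (- (path_image c2 \<union> path_image c3)) z q1 \<and>
             connected_component (- (path_image c1 \<union> path_image c3)) z q2)"
proof
  assume conn: "connected_component (- (path_image c2 \<union> path_image c3)) z q1 \<and>
             connected_component (- (path_image c1 \<union> path_image c3)) z q2"
  have "a \<noteq> b" using arcs(1) ends(1,2) arc_distinct_ends by blast
  have "path_image c3 \<inter> inside (path_image c1 \<union> path_image c2) \<noteq> {}"
    using q by blast
  then have
    sub: "inside (path_image c1 \<union> path_image c3) \<union> inside (path_image c2 \<union> path_image c3) \<union>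
      (path_image c3 - {a, b}) = inside (path_image c1 \<union> path_image c2)"
    using split_inside_simple_closed_curve[OF arcs(1)[THEN arc_imp_simple_path] ends(1,2)
        arcs(2)[THEN arc_imp_simple_path] ends(3,4) arcs(3)[THEN arc_imp_simple_path] ends(5,6)
        \<open>a \<noteq> b\<close> int] by blast
  have "q1 \<notin> inside (path_image c1 \<union> path_image c2)" "q2 \<notin> inside (path_image c1 \<union> path_image c2)"
    using q inside_no_overlap[of "path_image c1 \<union> path_image c2"] by blast+
  moreover from sub z consider "z \<in> inside (path_image c1 \<union> path_image c3)" |
     "z \<in> inside (path_image c2 \<union> path_image c3)"
    by blast
  ultimately show False
    using conn inside_same_component sub by (metis UnCI)
qed

text \<open>This is the nonplanarity of \<open>K33\<close> with sides \<open>a\<close>,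
  \<open>b\<close>, \<open>z\<close> and \<open>q1\<close>, \<open>q2\<close>, \<open>q3\<close>. If
  \<open>z\<close> is inside the curve formed by \<open>c1\<close> and \<open>c2\<close>, so is
  \<open>q3\<close>, and the chord lemma applies. Otherwise an inversion about an inside point turns
  the curve inside out.\<close>

lemma theta_separation:
  fixes c1 c2 c3 :: "real \<Rightarrow> complex"
  assumes arcs: "arc c1" "arc c2" "arc c3"
    and ends: "pathstart c1 = a" "pathfinish c1 = b" "pathstart c2 = a" "pathfinish c2 = b"
      "pathstart c3 = a" "pathfinish c3 = b"
    and int: "path_image c1 \<inter> path_image c2 = {a, b}" "path_image c1 \<inter> path_image c3 = {a, b}"
      "path_image c2 \<inter> path_image c3 = {a, b}"
    and q: "q1 \<in> path_image c1" "q2 \<in> path_image c2" "q3 \<in> path_image c3"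
    and conn1: "connected_component (- (path_image c2 \<union> path_image c3)) z q1"
    and conn2: "connected_component (- (path_image c1 \<union> path_image c3)) z q2"
    and conn3: "connected_component (- (path_image c1 \<union> path_image c2)) z q3"
  shows False
proof -
  let ?J = "path_image c1 \<union> path_image c2"
  have znot: "z \<notin> path_image c1" "z \<notin> path_image c2" "z \<notin> path_image c3"
    using conn1 conn2 connected_component_in by fastforce+
  show False
  proof (cases "z \<in> inside ?J")
    case True
    then have "q3 \<in> inside ?J" using conn3 inside_same_component by blast
    with theta_inside_separation[OF arcs ends int True znot(3) q this] conn1 conn2 show False
      by blast
  next
    case False
    have Jord: "inside (path_image d1 \<union> path_image d2) \<noteq> {} \<and> open (inside (path_image d1 \<union> path_image d2)) \<and>
       connected (outside (path_image d1 \<union> path_image d2)) \<and> compact (path_image d1 \<union> path_image d2)"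
      if "arc d1" "arc d2" "pathstart d1 = u" "pathfinish d1 = v" "pathstart d2 = u" "pathfinish d2 = v"
        "path_image d1 \<inter> path_image d2 = {u, v}" for d1 d2 :: "real \<Rightarrow> complex" and u v
    proof -
      have "simple_path (d1 +++ reversepath d2)"
        using that by (subst simple_path_join_loop_eq) (auto simp: arc_reversepath)
      moreover have "path_image (d1 +++ reversepath d2) = path_image d1 \<union> path_image d2"
        using that by (simp add: path_image_join)
      ultimately show ?thesis
        using Jordan_inside_outside[of "d1 +++ reversepath d2"] that
        by (auto simp: compact_Un compact_arc_image)
    qed
    note J = Jord[OF arcs(1,2) ends(1-4) int(1)]
    obtain w where w: "w \<in> inside ?J" using J by blast
    have wnot: "w \<notin> ?J" using w inside_no_overlap by blast
    have "q3 \<notin> ?J" using conn3 connected_component_in by fastforce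
    \<comment> \<open>Without its ends \<open>c3\<close> is connected and avoids \<open>?J\<close>,
      so a point \<open>w\<close> on it would lie in the component of \<open>q3\<close>, which is
      that of \<open>z\<close>; but \<open>z\<close> is not inside.\<close>
    have "w \<notin> path_image c3"
    proof
      assume "w \<in> path_image c3"
      have "connected (path_image c3 - {a, b})"
        using connected_simple_path_endless[of c3] arcs(3) ends(5,6) arc_imp_simple_path by blast
      then have "connected_component (- ?J) w q3"
        by (rule connected_componentI) (use int q \<open>w \<in> path_image c3\<close> wnot \<open>q3 \<notin> ?J\<close> in auto)
      then have "connected_component (- ?J) w z"
        using conn3 connected_component_trans connected_component_sym by blast
      then show False using w False inside_same_component by blast
    qed
    \<comment> \<open>\<open>f\<close> is an inversion sending \<open>w\<close> to infinity, and
      \<open>h\<close> undoes it. Since \<open>inverse 0 = 0\<close>, both are injective on the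
      whole plane, but they are continuous only off \<open>w\<close> and off
      \<open>0\<close>.\<close>
    define f where "f x = inverse (x - w)" for x
    define h where "h u = inverse u + w" for u
    have inj: "inj f" "inj h" by (auto simp: f_def h_def inj_def)
    have contf: "continuous_on (- {w}) f" unfolding f_def by (intro continuous_intros) auto
    have conth: "continuous_on (- {0}) h" unfolding h_def by (intro continuous_intros) auto
    have hf: "h (f x) = x" for x by (simp add: f_def h_def)
    have zw: "z \<noteq> w" using w False by blast
    have qw: "q1 \<noteq> w" "q2 \<noteq> w" "q3 \<noteq> w" using q wnot \<open>w \<notin> path_image c3\<close> by blast+
    have arcf: "arc (f \<circ> c)" if "arc c" "w \<notin> path_image c" for c
      using that inj continuous_on_subset[OF contf, of "path_image c"] unfolding arc_def
      by (auto intro!: path_continuous_image comp_inj_on intro: inj_on_subset)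
    have img: "path_image (f \<circ> c) = f ` path_image c" for c by (simp add: path_image_compose)
    have pts: "pathstart (f \<circ> c) = f (pathstart c)" "pathfinish (f \<circ> c) = f (pathfinish c)" for c
      by (simp_all add: pathstart_compose pathfinish_compose)
    have arcs': "arc (f \<circ> c1)" "arc (f \<circ> c2)" "arc (f \<circ> c3)"
      using arcf arcs wnot \<open>w \<notin> path_image c3\<close> by auto
    have int': "path_image (f \<circ> c1) \<inter> path_image (f \<circ> c2) = {f a, f b}"
      "path_image (f \<circ> c1) \<inter> path_image (f \<circ> c3) = {f a, f b}"
      "path_image (f \<circ> c2) \<inter> path_image (f \<circ> c3) = {f a, f b}"
      using int inj(1) by (simp_all add: img flip: image_Int)
    have ends': "pathstart (f \<circ> c1) = f a" "pathfinish (f \<circ> c1) = f b" "pathstart (f \<circ> c2) = f a"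
      "pathfinish (f \<circ> c2) = f b" "pathstart (f \<circ> c3) = f a" "pathfinish (f \<circ> c3) = f b"
      using ends by (simp_all add: pts)
    note J' = Jord[OF arcs'(1,2) ends'(1-4) int'(1)]
    have imgs: "path_image (f \<circ> c) \<union> path_image (f \<circ> c') = f ` (path_image c \<union> path_image c')" for c c'
      by (auto simp: img)
    note J'' = J'[unfolded imgs]
    have znot': "f z \<notin> f ` ?J" using znot inj(1) by (auto dest: injD)
    \<comment> \<open>Points near \<open>w\<close> are inside \<open>?J\<close>, and
      \<open>f\<close> sends them beyond every bound, hence outside the image curve. If
      \<open>f z\<close> were outside too, \<open>h\<close> would pull back a connection from
      \<open>z\<close> to a point inside \<open>?J\<close>.\<close>
    have fz: "f z \<in> inside (f ` ?J)"
    proof (rule ccontr)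
      assume "f z \<notin> inside (f ` ?J)"
      then have 1: "f z \<in> outside (f ` ?J)" using znot' inside_Un_outside by blast
      have "bounded (f ` ?J)" using J'' compact_imp_bounded by blast
      then obtain B where "\<forall>y\<in>f ` ?J. norm y \<le> B" unfolding bounded_iff by blast
      then have B: "f ` ?J \<subseteq> cball 0 B" unfolding subset_iff mem_cball_0 by blast
      obtain e where e: "e > 0" "ball w e \<subseteq> inside ?J"
        using J w open_contains_ball by blast
      \<comment> \<open>The first bound keeps \<open>x\<close> in the ball around \<open>w\<close>;
        the second makes \<open>norm (f x) = 1 / r\<close> exceed \<open>B\<close>.\<close>
      define r where "r = min (e/2) (1 / (1 + \<bar>B\<bar>))"
      have r: "r > 0" "r < e" "r \<le> 1 / (1 + \<bar>B\<bar>)" using e by (auto simp: r_def)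
      define x where "x = w + of_real r"
      have xin: "x \<in> inside ?J" using e r by (intro subsetD[OF e(2)]) (simp add: x_def dist_norm)
      have "x \<noteq> w" using r by (simp add: x_def)
      have "norm (f x) = 1 / r" using r by (simp add: f_def x_def norm_inverse divide_inverse)
      moreover have "1 + \<bar>B\<bar> \<le> 1 / r" using r(1,3) by (simp add: pos_le_divide_eq mult.commute)
      ultimately have "f x \<in> - cball 0 B" by simp
      then have 2: "f x \<in> outside (f ` ?J)"
        using outside_subset_convex[OF convex_cball B] by blast
      have "connected_component (- (f ` ?J)) (f z) (f x)"
        using J'' outside_no_overlap[of "f ` ?J"]
        by (intro connected_componentI[OF _ _ 1 2]) blast+
      moreover have "closed (f ` ?J)" using J'' compact_imp_closed by blast
      moreover have "f z \<noteq> 0" "f x \<noteq> 0" using zw \<open>x \<noteq> w\<close> by (auto simp: f_def)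
      ultimately have "connected_component (- (h ` f ` ?J)) (h (f z)) (h (f x))"
        by (rule connected_component_injective_image[OF _ _ _ _ inj(2) conth])
      then have "connected_component (- ?J) z x" by (simp add: image_image hf)
      then show False using xin False inside_same_component connected_component_sym by blast
    qed
    have transfer: "connected_component (- (path_image (f \<circ> c) \<union> path_image (f \<circ> c'))) (f z) (f y)"
      if "connected_component (- (path_image c \<union> path_image c')) z y" "y \<noteq> w" "arc c" "arc c'" for c c' y
      unfolding imgs
      by (rule connected_component_injective_image[OF that(1) _ zw that(2) inj(1) contf])
        (use that in \<open>auto intro: closed_arc_image\<close>)
    have "f q3 \<in> inside (f ` ?J)"
      using transfer[OF conn3 qw(3) arcs(1,2)] fz inside_same_component imgs by metis
    moreover have "f q1 \<in> f ` path_image c1" "f q2 \<in> f ` path_image c2" "f q3 \<in> f ` path_image c3"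
      using q by blast+
    moreover have "f z \<notin> f ` path_image c3" using znot(3) inj(1) by (auto dest: injD)
    ultimately show False
      using theta_inside_separation[OF arcs' ends' int', of "f z" "f q1" "f q2" "f q3", unfolded imgs]
        transfer[OF conn1 qw(1) arcs(2,3), unfolded imgs] transfer[OF conn2 qw(2) arcs(1,3), unfolded imgs] fz
      unfolding img by blast
  qed
qed

text \<open>Joining the edges from \<open>a 0\<close> and \<open>a 1\<close> at \<open>b j\<close>
  gives three arcs \<open>c j\<close> that meet only at their ends, and \<open>a 2\<close> reaches
  each \<open>b j\<close> off the other two arcs. Edges are sets \<open>A i j\<close> rather than
  arcs, so that subdivided edges fit directly.\<close>

lemma no_plane_K33:
  fixes a b :: "nat \<Rightarrow> complex" and A :: "nat \<Rightarrow> nat \<Rightarrow> complex set"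
  assumes inj: "inj_on a {..<3}" "inj_on b {..<3}" and ab: "\<And>i j. i < 3 \<Longrightarrow> j < 3 \<Longrightarrow> a i \<noteq> b j"
    and conn: "\<And>i j. i < 3 \<Longrightarrow> j < 3 \<Longrightarrow> path_component (A i j) (a i) (b j)"
    and disj: "\<And>i j i' j'. \<lbrakk>i < 3; j < 3; i' < 3; j' < 3; (i, j) \<noteq> (i', j')\<rbrakk> \<Longrightarrow>
       A i j \<inter> A i' j' \<subseteq> {a i, b j} \<inter> {a i', b j'}"
  shows False
proof -
  have "\<exists>g. arc g \<and> path_image g \<subseteq> A i j \<and> pathstart g = a i \<and> pathfinish g = b j"
    if ij: "i < 3" "j < 3" for i j
  proof -
    from conn[OF ij] obtain h where h: "path h" "path_image h \<subseteq> A i j" "pathstart h = a i" "pathfinish h = b j"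
      by (auto simp: path_component_def)
    from path_contains_arc[OF h(1,3,4) ab[OF ij]] h(2) show ?thesis by (metis order_trans)
  qed
  then obtain g where "\<forall>i<3. \<forall>j<3. arc (g i j) \<and> path_image (g i j) \<subseteq> A i j \<and>
      pathstart (g i j) = a i \<and> pathfinish (g i j) = b j"
    by metis
  then have g: "arc (g i j)" "path_image (g i j) \<subseteq> A i j" "pathstart (g i j) = a i"
      "pathfinish (g i j) = b j" if "i < 3" "j < 3" for i j
    using that by blast+
  define c where "c j = g 0 j +++ reversepath (g 1 j)" for j
  have c: "arc (c j)" "pathstart (c j) = a 0" "pathfinish (c j) = a 1"
    "path_image (c j) = path_image (g 0 j) \<union> path_image (g 1 j)" if "j < 3" for j
  proof -
    have "path_image (g 0 j) \<inter> path_image (g 1 j) \<subseteq> {b j}"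
      using g(2)[of 0 j] g(2)[of 1 j] disj[of 0 j 1 j] that inj_onD[OF inj(1), of 0 1] ab[of 1 j] by auto
    then show "arc (c j)" unfolding c_def using that
      by (subst arc_join_eq) (auto simp: g arc_reversepath)
  qed (use that in \<open>auto simp: c_def g path_image_join\<close>)
  have a01: "a 0 \<in> path_image (c j)" "a 1 \<in> path_image (c j)" if "j < 3" for j
    using c[OF that] by (metis pathstart_in_path_image, metis pathfinish_in_path_image)
  have b: "b j \<in> path_image (c j)" if "j < 3" for j
    using c(4)[OF that] g(4)[of 0 j] that pathfinish_in_path_image[of "g 0 j"] by auto
  have int: "path_image (c j) \<inter> path_image (c k) = {a 0, a 1}" if "j < 3" "k < 3" "j \<noteq> k" for j k
  proof
    have "A i j \<inter> A i' k \<subseteq> {a 0, a 1}" if "i < 2" "i' < 2" for i i'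
      using disj[of i j i' k] that \<open>j < 3\<close> \<open>k < 3\<close> \<open>j \<noteq> k\<close> inj_onD[OF inj(2), of j k] ab[of i k] ab[of i' j]
      by (auto simp: numeral_2_eq_2 less_Suc_eq)
    from this[of 0 0] this[of 0 1] this[of 1 0] this[of 1 1]
    show "path_image (c j) \<inter> path_image (c k) \<subseteq> {a 0, a 1}"
      unfolding c(4)[OF that(1)] c(4)[OF that(2)]
      using g(2)[of 0 j] g(2)[of 1 j] g(2)[of 0 k] g(2)[of 1 k] that by auto
  qed (use a01 that in auto)
  have sep: "connected_component (- (path_image (c k) \<union> path_image (c l))) (a 2) (b j)"
    if "j < 3" "k < 3" "l < 3" "j \<noteq> k" "j \<noteq> l" for j k l
  proof -
    have "A 2 j \<inter> A i m = {}" if "i < 2" "m < 3" "j \<noteq> m" for i m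
    proof -
      have "{a 2, b j} \<inter> {a i, b m} = {}"
        using that \<open>j < 3\<close> inj_onD[OF inj(1), of 2 i] ab[of i j] ab[of 2 m] inj_onD[OF inj(2), of j m]
        by auto
      moreover have "A 2 j \<inter> A i m \<subseteq> {a 2, b j} \<inter> {a i, b m}"
        using that \<open>j < 3\<close> by (intro disj) auto
      ultimately show ?thesis by blast
    qed
    from this[of 0 k] this[of 1 k] this[of 0 l] this[of 1 l]
    have "A 2 j \<subseteq> - (path_image (c k) \<union> path_image (c l))"
      unfolding c(4)[OF that(2)] c(4)[OF that(3)]
      using g(2)[of 0 k] g(2)[of 1 k] g(2)[of 0 l] g(2)[of 1 l] that by auto
    then have "path_component (- (path_image (c k) \<union> path_image (c l))) (a 2) (b j)"
      using conn[of 2 j] that(1) by (auto intro: path_component_of_subset)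
    then show ?thesis using path_component_subset_connected_component by blast
  qed
  show False
    by (rule theta_separation[of "c 0" "c 1" "c 2" "a 0" "a 1" "b 0" "b 1" "b 2" "a 2"])
      (rule c int b sep; simp)+
qed

section \<open>Subdivisions in plane drawings\<close>

definition linked :: "'a set set \<Rightarrow> 'a set \<Rightarrow> 'a \<Rightarrow> 'a \<Rightarrow> bool" where
  "linked E A x y \<longleftrightarrow> (x, y) \<in> {(u, v). u \<in> A \<and> v \<in> A \<and> {u, v} \<in> E}\<^sup>*"

text \<open>The graph \<open>(V, E)\<close> contains a subdivision of the graph on \<open>{..<r}\<close> with edges \<open>Y\<close>: the branch
  vertices are the \<open>b i\<close>, and the path replacing an edge \<open>e\<close> has its interior vertices in \<open>Q e\<close>.\<close>

definition has_subdivision :: "'a set set \<Rightarrow> 'a set \<Rightarrow> nat \<Rightarrow> (nat \<times> nat) set \<Rightarrow> bool" where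
  "has_subdivision E V r Y \<longleftrightarrow> (\<exists>b Q. inj_on b {..<r} \<and> b ` {..<r} \<subseteq> V \<and>
     (\<forall>e\<in>Y. Q e \<subseteq> V - b ` {..<r}) \<and> disjoint_family_on Q Y \<and>
     (\<forall>(i, j)\<in>Y. linked E ({b i, b j} \<union> Q (i, j)) (b i) (b j)))"

text \<open>The arcs along the chain of edges are concatenated. A trivial chain uses no edge, so the
  union of arcs may then be empty; hence \<open>x \<noteq> y\<close>.\<close>

lemma linked_path_component:
  assumes draw: "plane_drawing G p \<gamma>" and "linked (edges G) X x y" "x \<noteq> y"
  shows "path_component (\<Union>e\<in>{e\<in>edges G. e \<subseteq> X}. path_image (\<gamma> e)) (p x) (p y)"
proof -
  let ?A = "\<Union>e\<in>{e\<in>edges G. e \<subseteq> X}. path_image (\<gamma> e)"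
  have "x = y \<or> path_component ?A (p x) (p y)"
    using assms(2) unfolding linked_def
  proof (induction rule: rtrancl_induct)
    case (step y z)
    let ?e = "{y, z}"
    have e: "?e \<in> edges G" "?e \<subseteq> X" using step by auto
    then have arc: "arc (\<gamma> ?e)" "{pathstart (\<gamma> ?e), pathfinish (\<gamma> ?e)} = p ` ?e"
      using draw by (auto simp: plane_drawing_def)
    then have "p y \<in> path_image (\<gamma> ?e)" "p z \<in> path_image (\<gamma> ?e)"
      using pathstart_in_path_image[of "\<gamma> ?e"] pathfinish_in_path_image[of "\<gamma> ?e"]
      by (auto simp: doubleton_eq_iff)
    moreover have "path_connected (path_image (\<gamma> ?e))"
      using arc by (simp add: path_connected_path_image arc_imp_path)
    ultimately have "path_component (path_image (\<gamma> ?e)) (p y) (p z)"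
      by (simp add: path_connected_component)
    then have "path_component ?A (p y) (p z)"
      by (rule path_component_of_subset[rotated]) (use e in blast)
    then show ?case using step.IH path_component_trans by blast
  qed simp
  with \<open>x \<noteq> y\<close> show ?thesis by simp
qed

text \<open>Indices 0 to 2 and 3 to 5 label the two sides. \<open>X i j\<close> holds the vertices
  of one subdivided edge. Two such sets share only branch vertices, so the arcs drawn inside them
  meet only at common branch points.\<close>

lemma planar_no_K33_subdivision:
  fixes G :: "'a ugraph"
  assumes "planar_graph G"
  shows "\<not> has_subdivision (edges G) (vertices G) 6 ({..<3} \<times> {3..<6})"
proof
  assume "has_subdivision (edges G) (vertices G) 6 ({..<3} \<times> {3..<6})"
  then obtain b :: "nat \<Rightarrow> 'a" and Q :: "nat \<times> nat \<Rightarrow> 'a set"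
    where b: "inj_on b {..<6}" "b ` {..<6} \<subseteq> vertices G"
    and Q: "\<forall>e\<in>{..<3} \<times> {3..<6}. Q e \<subseteq> vertices G - b ` {..<6}"
    and disj: "disjoint_family_on Q ({..<3} \<times> {3..<6})"
    and link: "\<forall>(i, j)\<in>{..<3} \<times> {3..<6}. linked (edges G) ({b i, b j} \<union> Q (i, j)) (b i) (b j)"
    unfolding has_subdivision_def by blast
  obtain p \<gamma> where draw: "plane_drawing G p \<gamma>" and "simple_graph G"
    using assms by (auto simp: planar_graph_def)
  have p: "inj_on p (vertices G)" using draw by (simp add: plane_drawing_def)
  have pb: "p (b i) = p (b j) \<longleftrightarrow> i = j" if "i < 6" "j < 6" for i j
    using that b inj_onD[OF p, of "b i" "b j"] inj_onD[OF b(1), of i j] by auto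
  define X where "X i j = {b i, b (3 + j)} \<union> Q (i, 3 + j)" for i j
  define A where "A i j = (\<Union>e\<in>{e\<in>edges G. e \<subseteq> X i j}. path_image (\<gamma> e))" for i j
  show False
  proof (rule no_plane_K33[of "\<lambda>i. p (b i)" "\<lambda>j. p (b (3 + j))" A])
    fix i j :: nat assume ij: "i < 3" "j < 3"
    then show "p (b i) \<noteq> p (b (3 + j))" using pb[of i "3 + j"] by simp
    then show "path_component (A i j) (p (b i)) (p (b (3 + j)))"
      unfolding A_def X_def using ij link
      by (intro linked_path_component[OF draw]) auto
  next
    fix i j i' j' :: nat
    assume ij: "i < 3" "j < 3" "i' < 3" "j' < 3" "(i, j) \<noteq> (i', j')"
    have "Q (i, 3 + j) \<inter> Q (i', 3 + j') = {}"
      using disj ij unfolding disjoint_family_on_def by auto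
    moreover have "Q (i, 3 + j) \<inter> b ` {..<6} = {}" "Q (i', 3 + j') \<inter> b ` {..<6} = {}"
      using Q[rule_format, of "(i, 3 + j)"] Q[rule_format, of "(i', 3 + j')"] ij by auto
    moreover have "{b i, b (3 + j), b i', b (3 + j')} \<subseteq> b ` {..<6}" using ij by auto
    ultimately have X: "X i j \<inter> X i' j' = {b i, b (3 + j)} \<inter> {b i', b (3 + j')}"
      unfolding X_def by auto
    have bne: "b i \<noteq> b (3 + j')" "b i' \<noteq> b (3 + j)" "b i \<noteq> b (3 + j)" "b i' \<noteq> b (3 + j')"
      using inj_onD[OF b(1), of i "3 + j'"] inj_onD[OF b(1), of i' "3 + j"]
        inj_onD[OF b(1), of i "3 + j"] inj_onD[OF b(1), of i' "3 + j'"] ij by auto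
    show "A i j \<inter> A i' j' \<subseteq> {p (b i), p (b (3 + j))} \<inter> {p (b i'), p (b (3 + j'))}"
    proof
      fix t assume "t \<in> A i j \<inter> A i' j'"
      then obtain e e' where e: "e \<in> edges G" "e \<subseteq> X i j" "t \<in> path_image (\<gamma> e)"
        and e': "e' \<in> edges G" "e' \<subseteq> X i' j'" "t \<in> path_image (\<gamma> e')"
        unfolding A_def by auto
      have card: "card e = 2" "e \<subseteq> vertices G" "e' \<subseteq> vertices G"
        using \<open>simple_graph G\<close> e e' by (auto simp: simple_graph_def)
      \<comment> \<open>A common edge would have both ends among the shared branch vertices, but two
        different edges of \<open>K33\<close> share at most one.\<close>
      have "e \<noteq> e'"
      proof
        assume "e = e'"
        with e e' X have sub: "e \<subseteq> {b i, b (3 + j)} \<inter> {b i', b (3 + j')}" by auto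
        have "\<not> (b i = b i' \<and> b (3 + j) = b (3 + j'))"
          using inj_onD[OF b(1), of i i'] inj_onD[OF b(1), of "3 + j" "3 + j'"] ij by auto
        then have "card ({b i, b (3 + j)} \<inter> {b i', b (3 + j')}) \<le> 1"
          using bne by (auto simp: card_le_Suc0_iff_eq)
        then show False using card_mono[OF _ sub] card by simp
      qed
      with draw e e' have "t \<in> p ` e" "t \<in> p ` e'"
        unfolding plane_drawing_def by blast+
      then obtain u u' where u: "u \<in> e" "u' \<in> e'" "t = p u" "t = p u'" by auto
      then have "u = u'" using inj_onD[OF p, of u u'] card by auto
      then have "u \<in> X i j \<inter> X i' j'" using u e e' by auto
      then show "t \<in> {p (b i), p (b (3 + j))} \<inter> {p (b i'), p (b (3 + j'))}"
        using X u by auto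
    qed
  qed (auto simp: inj_on_def pb)
qed

section \<open>Dense graphs contain subdivisions\<close>

lemma linked_mono: "linked E A x y \<Longrightarrow> A \<subseteq> B \<Longrightarrow> linked E B x y"
  unfolding linked_def by (erule rtrancl_mono[THEN subsetD, rotated]) auto

lemma linked_trans: "linked E A x y \<Longrightarrow> linked E A y z \<Longrightarrow> linked E A x z"
  unfolding linked_def by (rule rtrancl_trans)

lemma linked_edge: "x \<in> A \<Longrightarrow> y \<in> A \<Longrightarrow> {x, y} \<in> E \<Longrightarrow> linked E A x y"
  unfolding linked_def by auto

lemma card_incident_edges:
  assumes "\<And>e. e \<in> E \<Longrightarrow> card e = 2" "v \<in> W"
  shows "card {e \<in> E. e \<subseteq> W \<and> v \<in> e} = card {u \<in> W. {v, u} \<in> E}"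
proof (rule bij_betw_same_card[symmetric])
  show "bij_betw (\<lambda>u. {v, u}) {u \<in> W. {v, u} \<in> E} {e \<in> E. e \<subseteq> W \<and> v \<in> e}"
    unfolding bij_betw_def
  proof (intro conjI equalityI subsetI)
    fix e assume "e \<in> {e \<in> E. e \<subseteq> W \<and> v \<in> e}"
    then have e: "e \<in> E" "e \<subseteq> W" "v \<in> e" "card e = 2" using assms(1) by auto
    then obtain u where "e = {v, u}" by (auto simp: card_2_iff)
    then show "e \<in> (\<lambda>u. {v, u}) ` {u \<in> W. {v, u} \<in> E}" using e by auto
  qed (use assms in \<open>auto simp: inj_on_def doubleton_eq_iff\<close>)
qed

lemma sum_card_incident_edges:
  assumes "finite W" "finite E" "\<And>e. e \<in> E \<Longrightarrow> card e = 2"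
  shows "(\<Sum>v\<in>W. card {e \<in> E. e \<subseteq> W \<and> v \<in> e}) = 2 * card {e \<in> E. e \<subseteq> W}"
proof -
  have "(\<Sum>v\<in>W. card {e \<in> {e \<in> E. e \<subseteq> W}. v \<in> e}) = (\<Sum>e\<in>{e \<in> E. e \<subseteq> W}. 2)"
  proof (rule sum_multicount_gen)
    show "\<forall>e\<in>{e \<in> E. e \<subseteq> W}. card {v \<in> W. v \<in> e} = 2"
    proof
      fix e assume e: "e \<in> {e \<in> E. e \<subseteq> W}"
      then have "{v \<in> W. v \<in> e} = e" by auto
      then show "card {v \<in> W. v \<in> e} = 2" using e assms by simp
    qed
  qed (use assms in auto)
  then show ?thesis by simp
qed

text \<open>Mader's argument: let \<open>U\<close> be a maximal connected set such that contracting \<open>U\<close> to a single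
  vertex keeps the number of edges at least \<open>K\<close> times the number of vertices. Adding a neighbour \<open>v\<close>
  of \<open>U\<close> to \<open>U\<close> costs one vertex and \<open>1 + d\<close> edges, where \<open>d\<close> is the degree of \<open>v\<close> within the
  neighbourhood of \<open>U\<close>; hence \<open>d \<ge> K\<close>.\<close>

lemma dense_neighbourhood:
  assumes "finite V" "V \<noteq> {}" and E: "finite E" "\<And>e. e \<in> E \<Longrightarrow> card e = 2" and "K > 0"
    and "K * card V \<le> card {e \<in> E. e \<subseteq> V}"
  shows "\<exists>U N. U \<subseteq> V \<and> N \<subseteq> V - U \<and> N \<noteq> {} \<and> (\<forall>u\<in>U. \<forall>v\<in>U. linked E U u v) \<and>
     (\<forall>v\<in>N. \<exists>u\<in>U. {u, v} \<in> E) \<and> (\<forall>v\<in>N. K \<le> card {e \<in> E. e \<subseteq> N \<and> v \<in> e})"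
  using assms(1,2,6)
proof (induction "card V" arbitrary: V rule: less_induct)
  case (less V)
  define nb where "nb U = {v \<in> V - U. \<exists>u\<in>U. {u, v} \<in> E}" for U
  \<comment> \<open>After contraction of \<open>U\<close> there are \<open>card (V - U) + 1\<close>
    vertices, and \<open>card (nb U)\<close> edges at the contracted vertex, parallel edges being
    merged.\<close>
  define good where "good U \<longleftrightarrow> U \<subseteq> V \<and> U \<noteq> {} \<and> (\<forall>u\<in>U. \<forall>v\<in>U. linked E U u v) \<and>
     K * (card (V - U) + 1) \<le> card {e \<in> E. e \<subseteq> V - U} + card (nb U)" for U
  have split: "card {e \<in> E. e \<subseteq> W} = card {e \<in> E. e \<subseteq> W - {v}} + card {u \<in> W. {v, u} \<in> E}"
    if "v \<in> W" for W v
  proof -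
    have "{e \<in> E. e \<subseteq> W} = {e \<in> E. e \<subseteq> W - {v}} \<union> {e \<in> E. e \<subseteq> W \<and> v \<in> e}" by auto
    then have "card {e \<in> E. e \<subseteq> W} = card {e \<in> E. e \<subseteq> W - {v}} + card {e \<in> E. e \<subseteq> W \<and> v \<in> e}"
      using E by (auto simp: intro!: card_Un_disjoint)
    then show ?thesis using card_incident_edges[of E v W] E that by simp
  qed
  obtain v0 where "v0 \<in> V" using less.prems by auto
  have "good {v0}"
  proof -
    have "nb {v0} = {u \<in> V. {v0, u} \<in> E}" using E(2)[of "{v0}"] by (auto simp: nb_def)
    then have "card {e \<in> E. e \<subseteq> V} = card {e \<in> E. e \<subseteq> V - {v0}} + card (nb {v0})"
      using split[OF \<open>v0 \<in> V\<close>] by simp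
    moreover have "card (V - {v0}) + 1 = card V"
      using \<open>v0 \<in> V\<close> less.prems card_Suc_Diff1 by fastforce
    ultimately show ?thesis unfolding good_def using \<open>v0 \<in> V\<close> less.prems by (simp add: linked_def)
  qed
  moreover have "\<forall>U. good U \<longrightarrow> card U \<le> card V"
    using less.prems by (auto simp: good_def intro: card_mono)
  ultimately obtain U where U: "good U" and max: "\<And>U'. good U' \<Longrightarrow> card U' \<le> card U"
    using ex_has_greatest_nat[of good "{v0}" card "Suc (card V)"] by (auto simp: less_Suc_eq_le)
  have UV: "U \<subseteq> V" "U \<noteq> {}" and conn: "\<And>u v. u \<in> U \<Longrightarrow> v \<in> U \<Longrightarrow> linked E U u v"
    and dens: "K * (card (V - U) + 1) \<le> card {e \<in> E. e \<subseteq> V - U} + card (nb U)"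
    using U by (auto simp: good_def)
  have fin: "finite U" "finite (V - U)" "finite (nb U)"
    using UV less.prems by (auto simp: nb_def intro: finite_subset)
  show ?case
  proof (cases "nb U = {}")
    case True
    \<comment> \<open>Without neighbours the contracted vertex is isolated, so \<open>V - U\<close>
      is itself dense and the induction hypothesis applies to it. If \<open>V - U\<close> were
      empty, \<open>dens\<close> would give \<open>K \<le> 0\<close>.\<close>
    have ne: "V - U \<noteq> {}"
    proof
      assume VU: "V - U = {}"
      have "{e \<in> E. e \<subseteq> {}} = {}" using E(2)[of "{}"] by auto
      from dens[unfolded True VU this] show False using \<open>K > 0\<close> by simp
    qed
    have "card (V - U) < card V" using UV less.prems by (intro psubset_card_mono) auto
    moreover have "K * card (V - U) \<le> card {e \<in> E. e \<subseteq> V - U}" using dens True by simp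
    ultimately obtain U' N where "U' \<subseteq> V - U" "N \<subseteq> V - U - U'" "N \<noteq> {}"
      "\<forall>u\<in>U'. \<forall>v\<in>U'. linked E U' u v" "\<forall>v\<in>N. \<exists>u\<in>U'. {u, v} \<in> E"
      "\<forall>v\<in>N. K \<le> card {e \<in> E. e \<subseteq> N \<and> v \<in> e}"
      using less.hyps[of "V - U"] ne fin(2) by blast
    then show ?thesis by blast
  next
    case False
    have "K \<le> card {e \<in> E. e \<subseteq> nb U \<and> v \<in> e}" if v: "v \<in> nb U" for v
    proof (rule ccontr)
      assume "\<not> K \<le> card {e \<in> E. e \<subseteq> nb U \<and> v \<in> e}"
      then have small: "card {u \<in> nb U. {v, u} \<in> E} < K"
        using card_incident_edges[of E v "nb U"] E v by simp
      have vV: "v \<in> V - U" using v by (auto simp: nb_def)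
      obtain u where u: "u \<in> U" "{u, v} \<in> E" using v by (auto simp: nb_def)
      \<comment> \<open>\<open>?X\<close> consists of the new neighbours gained when
        \<open>v\<close> joins \<open>U\<close>. The edges from \<open>v\<close> to
        \<open>?X\<close> survive, so only one vertex and at most \<open>K\<close> edges are lost
        and \<open>?U\<close> is good, against maximality.\<close>
      let ?U = "insert v U" and ?X = "{x \<in> V - U - nb U. {v, x} \<in> E}"
      have VU: "V - ?U = V - U - {v}" by auto
      have "{x \<in> V - U. {v, x} \<in> E} = {x \<in> nb U. {v, x} \<in> E} \<union> ?X" by (auto simp: nb_def)
      then have d: "card {x \<in> V - U. {v, x} \<in> E} = card {x \<in> nb U. {v, x} \<in> E} + card ?X"
        using fin by (auto intro!: card_Un_disjoint)
      have "nb ?U = (nb U - {v}) \<union> ?X" using v E(2)[of "{v}"] by (auto simp: nb_def insert_commute)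
      moreover have "card ((nb U - {v}) \<union> ?X) = card (nb U - {v}) + card ?X"
        by (rule card_Un_disjoint) (use fin in auto)
      ultimately have n: "card (nb ?U) = card (nb U - {v}) + card ?X" by simp
      have n': "card (nb U - {v}) + 1 = card (nb U)" using card_Suc_Diff1[OF fin(3) v] by simp
      have c: "card (V - ?U) + 1 = card (V - U)" using card_Suc_Diff1[OF fin(2) vV] VU by simp
      have "K * (card (V - ?U) + 1) + K = K * (card (V - U) + 1)" using c by simp
      then have "K * (card (V - ?U) + 1) \<le> card {e \<in> E. e \<subseteq> V - ?U} + card (nb ?U)"
        using dens split[OF vV] d n n' small unfolding VU by linarith
      moreover have "linked E ?U x y" if "x \<in> ?U" "y \<in> ?U" for x y
      proof -
        have "linked E ?U u v" "linked E ?U v u"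
          using u by (auto intro!: linked_edge simp: insert_commute)
        moreover have "linked E ?U x u" "linked E ?U u x" if "x \<in> U" for x
          using linked_mono[OF conn[OF that u(1)] subset_insertI]
            linked_mono[OF conn[OF u(1) that] subset_insertI] by auto
        ultimately have "linked E ?U x u" "linked E ?U u y" using that by auto
        then show ?thesis by (rule linked_trans)
      qed
      ultimately have "good ?U" using UV vV unfolding good_def by blast
      then show False using max[of ?U] vV fin by simp
    qed
    with False UV conn show ?thesis
      by (intro exI[of _ U] exI[of _ "nb U"]) (auto simp: nb_def)
  qed
qed

text \<open>Induction on \<open>Y\<close>, spending one factor 2 per pair.
  \<open>dense_neighbourhood\<close> with \<open>2 * K\<close> gives a set \<open>N\<close> of
  minimum degree at least \<open>2 * K\<close>, hence with at least \<open>K * card N\<close> edges.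
  The other pairs are realised in \<open>N\<close>, and the last one is joined through the connected
  set \<open>U\<close> disjoint from \<open>N\<close>.\<close>

lemma dense_has_subdivision:
  assumes "finite Y" "Y \<subseteq> {..<r} \<times> {..<r}" "r > 0" and E: "finite E" "\<And>e. e \<in> E \<Longrightarrow> card e = 2"
    and "finite V" "V \<noteq> {}" "2 ^ card Y * r * card V \<le> card {e \<in> E. e \<subseteq> V}"
  shows "has_subdivision E V r Y"
  using assms(1,2,6-)
proof (induction Y arbitrary: V rule: finite_induct)
  case empty
  \<comment> \<open>Without pairs only \<open>r\<close> distinct vertices are needed; so many edges
    cannot fit on fewer.\<close>
  have "r * card V \<le> card {e \<in> E. e \<subseteq> V}" using empty.prems by simp
  also have "card {e \<in> E. e \<subseteq> V} \<le> card {e. e \<subseteq> V \<and> card e = 2}"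
    using empty E by (intro card_mono) auto
  also have "\<dots> = card V choose 2" using empty by (simp add: n_subsets)
  also have "\<dots> \<le> card V * card V" by (simp add: choose_two mult_le_mono le_trans[OF div_le_dividend])
  finally have "r \<le> card V" using empty.prems by (simp add: card_gt_0_iff)
  then obtain b where b: "inj_on b {..<r}" "b ` {..<r} \<subseteq> V"
    using card_le_inj[of "{..<r}" V] empty by auto
  then show ?case unfolding has_subdivision_def
    by (intro exI[of _ b] exI[of _ "\<lambda>_. {}"]) (auto simp: disjoint_family_on_def)
next
  case (insert y Y)
  obtain i j where y: "y = (i, j)" by (cases y)
  have ij: "i < r" "j < r" using insert.prems y by auto
  define K where "K = 2 ^ card Y * r"
  have "2 * K * card V \<le> card {e \<in> E. e \<subseteq> V}" "2 * K > 0"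
    using insert.prems insert.hyps \<open>r > 0\<close> by (auto simp: K_def)
  from dense_neighbourhood[OF insert.prems(2,3) E this(2,1)]
  obtain U N where UN: "U \<subseteq> V" "N \<subseteq> V - U" "N \<noteq> {}" "\<forall>u\<in>U. \<forall>v\<in>U. linked E U u v"
     "\<forall>v\<in>N. \<exists>u\<in>U. {u, v} \<in> E" "\<forall>v\<in>N. 2 * K \<le> card {e \<in> E. e \<subseteq> N \<and> v \<in> e}" by blast
  have "finite N" using UN insert.prems by (meson finite_Diff finite_subset)
  have "2 * K * card N \<le> (\<Sum>v\<in>N. card {e \<in> E. e \<subseteq> N \<and> v \<in> e})"
    using sum_mono[of N "\<lambda>_. 2 * K"] UN by (simp add: mult.commute)
  also have "\<dots> = 2 * card {e \<in> E. e \<subseteq> N}" using \<open>finite N\<close> E by (rule sum_card_incident_edges)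
  finally have "has_subdivision E N r Y"
    using insert \<open>finite N\<close> UN by (intro insert.IH) (auto simp: K_def)
  then obtain b Q where b: "inj_on b {..<r}" "b ` {..<r} \<subseteq> N"
    and Q: "\<forall>e\<in>Y. Q e \<subseteq> N - b ` {..<r}" "disjoint_family_on Q Y"
      "\<forall>(i, j)\<in>Y. linked E ({b i, b j} \<union> Q (i, j)) (b i) (b j)"
    unfolding has_subdivision_def by blast
  define Q' where "Q' = Q(y := U)"
  have "linked E ({b i, b j} \<union> U) (b i) (b j)"
  proof -
    have "b i \<in> N" "b j \<in> N" using b ij by auto
    then obtain u v where uv: "u \<in> U" "{u, b i} \<in> E" "v \<in> U" "{v, b j} \<in> E" using UN by blast
    have "linked E ({b i, b j} \<union> U) (b i) u" "linked E ({b i, b j} \<union> U) v (b j)"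
      using uv by (auto intro!: linked_edge simp: insert_commute)
    moreover have "linked E ({b i, b j} \<union> U) u v"
      using UN(4) uv linked_mono[of E U u v "{b i, b j} \<union> U"] by blast
    ultimately show ?thesis using linked_trans by metis
  qed
  then have link: "\<forall>(i, j)\<in>insert y Y. linked E ({b i, b j} \<union> Q' (i, j)) (b i) (b j)"
    using Q(3) y by (auto simp: Q'_def)
  have QN: "Q e \<subseteq> N" if "e \<in> Y" for e using Q(1) that by blast
  have "\<forall>e\<in>insert y Y. Q' e \<subseteq> V - b ` {..<r}"
  proof
    fix e assume "e \<in> insert y Y"
    then show "Q' e \<subseteq> V - b ` {..<r}"
      using Q(1) b(2) UN(1,2) by (cases "e = y") (simp add: Q'_def, blast)+
  qed
  moreover have "disjoint_family_on Q' (insert y Y)"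
    unfolding disjoint_family_on_def
  proof (intro ballI impI)
    fix e f assume "e \<in> insert y Y" "f \<in> insert y Y" "e \<noteq> f"
    moreover have "Q e \<inter> U = {}" "U \<inter> Q e = {}" if "e \<in> Y" for e
      using QN[OF that] UN(2) by blast+
    moreover have "Q e \<inter> Q f = {}" if "e \<in> Y" "f \<in> Y"
      using that \<open>e \<noteq> f\<close> Q(2) unfolding disjoint_family_on_def by blast
    ultimately show "Q' e \<inter> Q' f = {}" unfolding Q'_def by (cases "e = y"; cases "f = y") auto
  qed
  moreover have "b ` {..<r} \<subseteq> V" using b(2) UN(2) by blast
  ultimately show ?case
    unfolding has_subdivision_def using b(1) link by blast
qed

section \<open>Edge density and \<open>K33\<close>-freeness of planar graphs\<close>

lemma planar_card_edges_le:
  assumes "planar_graph G"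
  shows "card (edges G) \<le> 3072 * card (vertices G)"
proof (cases "vertices G = {}")
  case True
  then have "edges G = {}" using assms by (fastforce simp: planar_graph_def simple_graph_def)
  then show ?thesis by simp
next
  case False
  let ?Y = "{..<3} \<times> {3..<6} :: (nat \<times> nat) set"
  have G: "finite (vertices G)" "\<And>e. e \<in> edges G \<Longrightarrow> card e = 2" "edges G \<subseteq> Pow (vertices G)"
    using assms by (auto simp: planar_graph_def simple_graph_def)
  have fin: "finite (edges G)" using finite_subset[OF G(3)] G(1) by simp
  have eq: "{e \<in> edges G. e \<subseteq> vertices G} = edges G" using G by auto
  have Y: "finite ?Y" "?Y \<subseteq> {..<6} \<times> {..<6}" "card ?Y = 9" by auto
  show ?thesis
  proof (rule ccontr)
    assume "\<not> ?thesis"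
    \<comment> \<open>The constant 3072 is \<open>2 ^ 9 * 6\<close>, from the nine edges and six
      vertices of \<open>K33\<close>.\<close>
    then have "2 ^ 9 * 6 * card (vertices G) \<le> card (edges G)" by simp
    then have "has_subdivision (edges G) (vertices G) 6 ?Y"
      using dense_has_subdivision[OF Y(1,2) _ fin G(2) G(1) False] unfolding Y(3) eq by simp
    then show False using planar_no_K33_subdivision[OF assms] by simp
  qed
qed

text \<open>A copy of \<open>K33\<close> is a subdivision whose interior sets \<open>Q e\<close> are
  all empty.\<close>

lemma planar_no_K33:
  fixes G :: "'a ugraph"
  assumes "planar_graph G" and AB: "A \<subseteq> vertices G" "B \<subseteq> vertices G" "A \<inter> B = {}" "card A = 3" "card B = 3"
  shows "\<exists>a\<in>A. \<exists>b\<in>B. {a, b} \<notin> edges G"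
proof (rule ccontr)
  assume "\<not> ?thesis"
  then have E: "\<And>a b. a \<in> A \<Longrightarrow> b \<in> B \<Longrightarrow> {a, b} \<in> edges G" by auto
  have "finite A" "finite B" using AB by (auto intro: card_ge_0_finite)
  then obtain f g :: "nat \<Rightarrow> 'a" where f: "bij_betw f {..<3} A" and g: "bij_betw g {3..<6} B"
    using AB finite_same_card_bij[of "{..<3::nat}" A] finite_same_card_bij[of "{3..<6::nat}" B] by fastforce
  define b where "b i = (if i < 3 then f i else g i)" for i :: nat
  have img: "b ` {..<3} = A" "b ` {3..<6} = B"
    using f g by (auto simp: b_def bij_betw_def)
  have six: "{..<6} = {..<3} \<union> {3..<6::nat}" by auto
  have "inj_on b {..<6}"
    unfolding six
    using f g img AB by (subst inj_on_Un) (auto simp: b_def bij_betw_def inj_on_def)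
  moreover have "b ` {..<6} \<subseteq> vertices G" unfolding six image_Un img using AB by auto
  moreover have "linked (edges G) {b i, b j} (b i) (b j)" if "i < 3" "3 \<le> j" "j < 6" for i j
    using that img by (intro linked_edge E) auto
  ultimately have "has_subdivision (edges G) (vertices G) 6 ({..<3} \<times> {3..<6})"
    unfolding has_subdivision_def
    by (intro exI[of _ b] exI[of _ "\<lambda>_. {}"]) (auto simp: disjoint_family_on_def)
  then show False using planar_no_K33_subdivision[OF assms(1)] by blast
qed

section \<open>Weighted paths\<close>

text \<open>The arithmetic-geometric mean inequality for one factor \<open>a\<close> and
  \<open>l\<close> factors \<open>b\<close>. It is Bernoulli's inequality at
  \<open>M / b - 1\<close>, with \<open>M\<close> the mean.\<close>

lemma mult_power_le_mean_power:
  fixes a b :: real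
  assumes "a \<ge> 0" "b \<ge> 0"
  shows "a * b ^ l \<le> ((a + real l * b) / real (Suc l)) ^ Suc l"
proof (cases "b = 0")
  case True
  then show ?thesis using assms by (cases l) auto
next
  case False
  then have b: "b > 0" using assms by simp
  define M where "M = (a + real l * b) / real (Suc l)"
  have M: "a = real (Suc l) * M - real l * b" by (simp add: M_def)
  have "M \<ge> 0" unfolding M_def using assms by simp
  then have "1 + real (Suc l) * (M / b - 1) \<le> (1 + (M / b - 1)) ^ Suc l"
    using b by (intro Bernoulli_inequality) simp
  also have "1 + real (Suc l) * (M / b - 1) = a / b"
    using b by (simp add: M field_simps)
  finally have "a / b \<le> (M / b) ^ Suc l" by simp
  then have "a / b * b ^ Suc l \<le> M ^ Suc l"
    using b by (simp add: power_divide pos_le_divide_eq)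
  then show ?thesis using b by (simp add: M_def)
qed

definition total_weight :: "('a \<Rightarrow> 'a \<Rightarrow> real) \<Rightarrow> 'a set \<Rightarrow> real" where
  "total_weight w B = (\<Sum>u\<in>B. \<Sum>v\<in>B - {u}. w u v) / 2"

text \<open>For \<open>x\<close> in \<open>B\<close> this sums the product of the edge weights over
  all paths in \<open>B\<close> with \<open>l\<close> edges that start at \<open>x\<close>.\<close>

primrec path_weight :: "('a \<Rightarrow> 'a \<Rightarrow> real) \<Rightarrow> nat \<Rightarrow> 'a set \<Rightarrow> 'a \<Rightarrow> real" where
  "path_weight w 0 B x = 1"
| "path_weight w (Suc l) B x = (\<Sum>y\<in>B - {x}. w x y * path_weight w l (B - {x}) y)"

lemma total_weight_nonneg:
  assumes "\<And>u v. w u v \<ge> 0"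
  shows "total_weight w B \<ge> 0"
  unfolding total_weight_def by (intro divide_nonneg_nonneg sum_nonneg) (auto simp: assms)

lemma total_weight_remove:
  assumes "finite B" "x \<in> B" and sym: "\<And>u v. w u v = w v u"
  shows "total_weight w B = total_weight w (B - {x}) + (\<Sum>v\<in>B - {x}. w x v)"
proof -
  have "(\<Sum>v\<in>B - {u}. w u v) = w x u + (\<Sum>v\<in>B - {x} - {u}. w u v)" if "u \<in> B - {x}" for u
    proof -
    have "B - {u} = insert x (B - {x} - {u})" using that assms by blast
    then show ?thesis using assms sym[of u x] by simp
  qed
  then have "(\<Sum>u\<in>B - {x}. \<Sum>v\<in>B - {u}. w u v) =
      (\<Sum>u\<in>B - {x}. w x u) + (\<Sum>u\<in>B - {x}. \<Sum>v\<in>B - {x} - {u}. w u v)"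
    by (simp add: sum.distrib)
  moreover have "(\<Sum>u\<in>B. \<Sum>v\<in>B - {u}. w u v) =
      (\<Sum>v\<in>B - {x}. w x v) + (\<Sum>u\<in>B - {x}. \<Sum>v\<in>B - {u}. w u v)"
    by (rule sum.remove) (use assms in auto)
  ultimately show ?thesis by (simp add: total_weight_def field_simps)
qed

text \<open>A path leaving \<open>x\<close> never returns, so the edges at \<open>x\<close>, of total weight \<open>d\<close>, are spent on its
  first step; the rest of the path has only weight \<open>W - d\<close> at its disposal.\<close>

lemma path_weight_le:
  assumes "finite B" "x \<in> B" and sym: "\<And>u v. w u v = w v u" and nonneg: "\<And>u v. w u v \<ge> 0"
  shows "path_weight w l B x \<le> (total_weight w B / real l) ^ l"
  using assms(1,2)
proof (induction l arbitrary: B x)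
  case 0
  then show ?case by simp
next
  case (Suc l)
  let ?d = "\<Sum>y\<in>B - {x}. w x y" and ?W = "total_weight w (B - {x})"
  have W: "?W \<ge> 0" using nonneg by (rule total_weight_nonneg)
  have "path_weight w (Suc l) B x \<le> (\<Sum>y\<in>B - {x}. w x y * (?W / real l) ^ l)"
    using Suc nonneg by (auto intro!: sum_mono mult_left_mono)
  also have "\<dots> = ?d * (?W / real l) ^ l" by (simp add: sum_distrib_right)
  also have "\<dots> \<le> ((?d + real l * (?W / real l)) / real (Suc l)) ^ Suc l"
    using W nonneg by (intro mult_power_le_mean_power) (auto intro: sum_nonneg)
  \<comment> \<open>\<open>real l * (?W / real l)\<close> is \<open>?W\<close>, except that division
    by zero makes it 0 for \<open>l = 0\<close>; an upper bound suffices.\<close>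
  also have "\<dots> \<le> (total_weight w B / real (Suc l)) ^ Suc l"
    using total_weight_remove[OF Suc.prems sym] W nonneg
    by (intro power_mono divide_right_mono) (auto intro!: divide_nonneg_nonneg sum_nonneg add_nonneg_nonneg)
  finally show ?case .
qed

text \<open>One factor \<open>d\<close> is the first step of the path, and the factor \<open>d\<^sup>2\<close> is balanced against the
  remaining steps.\<close>

lemma cube_mult_power_le:
  fixes d n :: real
  assumes "0 \<le> d" "d \<le> n"
  shows "d ^ 3 * ((n - d) / real l) ^ l \<le> 4 * d * (n / real (l + 2)) ^ (l + 2)"
proof -
  define b where "b = (n - d) / real l"
  have b: "b \<ge> 0" "real l * b \<le> n - d" using assms by (auto simp: b_def)
  let ?M = "(d / 2 + real l * b) / real (Suc l)"
  have M: "?M \<ge> 0" using assms b by simp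
  \<comment> \<open>Two factors \<open>d / 2\<close> and \<open>l\<close> factors \<open>b\<close>
    have sum at most \<open>n\<close>; the mean inequality is applied once for each
    \<open>d / 2\<close>. The third factor \<open>d\<close> stays outside, which gives
    \<open>4 * d\<close>.\<close>
  have "(d / 2) * b ^ l \<le> ?M ^ Suc l" using assms b by (intro mult_power_le_mean_power) auto
  then have "(d / 2) * ((d / 2) * b ^ l) \<le> (d / 2) * ?M ^ Suc l"
    using assms by (intro mult_left_mono) auto
  also have "\<dots> \<le> ((d / 2 + real (Suc l) * ?M) / real (Suc (Suc l))) ^ Suc (Suc l)"
    using assms M by (intro mult_power_le_mean_power) auto
  also have "\<dots> \<le> (n / real (Suc (Suc l))) ^ Suc (Suc l)"
    using assms b M by (intro power_mono divide_right_mono) (auto intro!: divide_nonneg_nonneg)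
  finally have "4 * d * ((d / 2) * ((d / 2) * b ^ l)) \<le> 4 * d * (n / real (Suc (Suc l))) ^ Suc (Suc l)"
    using assms by (intro mult_left_mono) auto
  then show ?thesis by (simp add: b_def power3_eq_cube field_simps)
qed

text \<open>Each \<open>x \<in> I\<close> has at most two neighbours in \<open>B\<close>, so if \<open>x\<close> is adjacent to \<open>y\<close>, it contributes
  nothing to the total weight of \<open>B - {y}\<close>.\<close>

lemma path_weight_star_le:
  fixes a :: "'b \<Rightarrow> 'a \<Rightarrow> real"
  assumes fin: "finite B" and y: "y \<in> B" and a01: "\<And>x u. a x u = 0 \<or> a x u = 1"
    and two: "\<And>x. x \<in> I \<Longrightarrow> (\<Sum>u\<in>B. a x u) \<le> 2"
  defines "c \<equiv> \<lambda>u v. \<Sum>x\<in>I. a x u * a x v" and "d \<equiv> \<Sum>x\<in>I. a x y"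
  shows "path_weight c (Suc l) B y \<le> d * ((real (card I) - d) / real l) ^ l"
proof -
  define s where "s x = (\<Sum>u\<in>B - {y}. a x u)" for x
  have a: "0 \<le> a x u" "a x u \<le> 1" "a x u * a x u = a x u" for x u
    using a01[of x u] by auto
  have s: "0 \<le> s x" for x unfolding s_def by (intro sum_nonneg a)
  have s2: "s x + a x y \<le> 2" if "x \<in> I" for x
    using two[OF that] sum.remove[OF fin y, of "a x"] by (simp add: s_def)
  have sym: "c u v = c v u" for u v by (simp add: c_def mult.commute)
  have nonneg: "c u v \<ge> 0" for u v unfolding c_def by (intro sum_nonneg mult_nonneg_nonneg a)
  have "(\<Sum>z\<in>B - {y}. c y z) = (\<Sum>x\<in>I. a x y * s x)"
    unfolding c_def s_def by (subst sum.swap) (simp add: sum_distrib_left)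
  \<comment> \<open>A vertex \<open>x\<close> adjacent to \<open>y\<close> has at most one other
    neighbour in \<open>B\<close>, so \<open>s x \<le> 1\<close>.\<close>
  also have "\<dots> \<le> d" unfolding d_def
  proof (rule sum_mono)
    fix x assume "x \<in> I"
    then show "a x y * s x \<le> a x y" using s2[of x] a01[of x y] by auto
  qed
  finally have deg: "(\<Sum>z\<in>B - {y}. c y z) \<le> d" .
  have "(\<Sum>u\<in>B - {y}. \<Sum>v\<in>B - {y} - {u}. c u v) =
      (\<Sum>u\<in>B - {y}. \<Sum>x\<in>I. a x u * (\<Sum>v\<in>B - {y} - {u}. a x v))"
    unfolding c_def by (rule sum.cong[OF refl], subst sum.swap) (simp add: sum_distrib_left)
  also have "\<dots> = (\<Sum>u\<in>B - {y}. \<Sum>x\<in>I. a x u * (s x - a x u))"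
    unfolding s_def using fin by (intro sum.cong refl) (simp add: sum_diff1)
  also have "\<dots> = (\<Sum>u\<in>B - {y}. \<Sum>x\<in>I. a x u * (s x - 1))"
    by (simp add: algebra_simps a)
  also have "\<dots> = (\<Sum>x\<in>I. s x * (s x - 1))"
    by (subst sum.swap) (simp add: s_def flip: sum_distrib_right)
  \<comment> \<open>\<open>s x * (s x - 1)\<close> counts ordered pairs of neighbours of
    \<open>x\<close> in \<open>B - {y}\<close>. If \<open>x\<close> is adjacent to \<open>y\<close>,
    then \<open>s x \<le> 1\<close> and there are none; otherwise
    \<open>(2 - s x) * (s x + 1) \<ge> 0\<close> bounds the count by 2.\<close>
  also have "\<dots> \<le> (\<Sum>x\<in>I. 2 * (1 - a x y))"
  proof (rule sum_mono)
    fix x assume x: "x \<in> I"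
    show "s x * (s x - 1) \<le> 2 * (1 - a x y)"
    proof (cases "a x y = 1")
      case True
      then show ?thesis using s[of x] s2[OF x] by (simp add: mult_nonneg_nonpos)
    next
      case False
      then have "a x y = 0" using a01 by blast
      moreover have "s x * (s x - 1) \<le> 2 * 1"
        using mult_nonneg_nonneg[of "2 - s x" "s x + 1"] s[of x] s2[OF x] \<open>a x y = 0\<close>
        by (simp add: algebra_simps)
      ultimately show ?thesis by simp
    qed
  qed
  also have "\<dots> = 2 * (real (card I) - d)"
    by (simp add: d_def sum_subtractf flip: sum_distrib_left)
  finally have W: "total_weight c (B - {y}) \<le> real (card I) - d"
    by (simp add: total_weight_def)
  have W0: "total_weight c (B - {y}) \<ge> 0" using nonneg by (rule total_weight_nonneg)
  have "path_weight c (Suc l) B y \<le> (\<Sum>z\<in>B - {y}. c y z * ((real (card I) - d) / real l) ^ l)"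
    unfolding path_weight.simps
  proof (intro sum_mono mult_left_mono nonneg)
    fix z assume "z \<in> B - {y}"
    then have "path_weight c l (B - {y}) z \<le> (total_weight c (B - {y}) / real l) ^ l"
      using fin sym nonneg by (intro path_weight_le) auto
    also have "\<dots> \<le> ((real (card I) - d) / real l) ^ l"
      using W W0 by (intro power_mono divide_right_mono) auto
    finally show "path_weight c l (B - {y}) z \<le> ((real (card I) - d) / real l) ^ l" .
  qed
  also have "\<dots> = (\<Sum>z\<in>B - {y}. c y z) * ((real (card I) - d) / real l) ^ l"
    by (simp add: sum_distrib_right)
  also have "\<dots> \<le> d * ((real (card I) - d) / real l) ^ l"
    using deg W W0 by (intro mult_right_mono) auto
  finally show ?thesis .
qed

text \<open>\<open>cube_mult_power_le\<close> with \<open>l = m - 2\<close> makes each summand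
  linear in \<open>d y\<close>, and double counting bounds the sum of all \<open>d y\<close> by
  \<open>2 * card I\<close>.\<close>

lemma sum_degree_path_weight_le:
  fixes a :: "'b \<Rightarrow> 'a \<Rightarrow> real"
  assumes fin: "finite B" and a01: "\<And>x u. a x u = 0 \<or> a x u = 1"
    and two: "\<And>x. x \<in> I \<Longrightarrow> (\<Sum>u\<in>B. a x u) \<le> 2" and "m \<ge> 2"
  defines "c \<equiv> \<lambda>u v. \<Sum>x\<in>I. a x u * a x v" and "d \<equiv> \<lambda>u. \<Sum>x\<in>I. a x u"
  shows "(\<Sum>y\<in>B. (d y)\<^sup>2 * path_weight c (m - 1) B y) \<le> 8 * real (card I) * (real (card I) / real m) ^ m"
proof -
  obtain l where l: "m = l + 2" using \<open>m \<ge> 2\<close> by (metis add.commute le_Suc_ex)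
  let ?n = "real (card I)"
  have a: "0 \<le> a x u" "a x u \<le> 1" for x u using a01[of x u] by auto
  have d: "0 \<le> d y" "d y \<le> ?n" for y
    unfolding d_def using sum_bounded_above[of I "\<lambda>x. a x y" 1] a by (auto intro: sum_nonneg)
  have "(d y)\<^sup>2 * path_weight c (m - 1) B y \<le> 4 * d y * (?n / real m) ^ m" if "y \<in> B" for y
  proof -
    have "path_weight c (Suc l) B y \<le> d y * ((?n - d y) / real l) ^ l"
      using path_weight_star_le[OF fin that a01 two] unfolding c_def d_def .
    then have "(d y)\<^sup>2 * path_weight c (Suc l) B y \<le> (d y)\<^sup>2 * (d y * ((?n - d y) / real l) ^ l)"
      by (intro mult_left_mono) auto
    also have "\<dots> = d y ^ 3 * ((?n - d y) / real l) ^ l" by (simp add: power2_eq_square power3_eq_cube)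
    also have "\<dots> \<le> 4 * d y * (?n / real m) ^ m" unfolding l using d by (rule cube_mult_power_le)
    finally show ?thesis by (simp add: l)
  qed
  then have "(\<Sum>y\<in>B. (d y)\<^sup>2 * path_weight c (m - 1) B y) \<le> (\<Sum>y\<in>B. 4 * d y * (?n / real m) ^ m)"
    by (rule sum_mono)
  also have "\<dots> = 4 * (\<Sum>y\<in>B. d y) * (?n / real m) ^ m"
    by (simp add: sum_distrib_left sum_distrib_right)
  also have "\<dots> \<le> 4 * (2 * ?n) * (?n / real m) ^ m"
  proof (intro mult_right_mono mult_left_mono)
    have "(\<Sum>y\<in>B. d y) = (\<Sum>x\<in>I. \<Sum>y\<in>B. a x y)" unfolding d_def by (rule sum.swap)
    also have "\<dots> \<le> (\<Sum>x\<in>I. 2)" using two by (rule sum_mono)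
    finally show "(\<Sum>y\<in>B. d y) \<le> 2 * ?n" by simp
  qed auto
  finally show ?thesis by simp
qed

section \<open>Weights of vertex lists\<close>

fun list_weight :: "('a \<Rightarrow> 'a \<Rightarrow> real) \<Rightarrow> 'a list \<Rightarrow> real" where
  "list_weight w (x # y # xs) = w x y * list_weight w (y # xs)"
| "list_weight w xs = 1"

lemma list_weight_nonneg: "(\<And>u v. w u v \<ge> 0) \<Longrightarrow> list_weight w xs \<ge> 0"
  by (induction w xs rule: list_weight.induct) auto

lemma list_weight_snoc: "list_weight w (xs @ [x, y]) = list_weight w (xs @ [x]) * w x y"
proof (induction xs)
  case (Cons z zs)
  then show ?case by (cases zs) auto
qed simp

lemma list_weight_rev:
  assumes "\<And>u v. w u v = w v u"
  shows "list_weight w (rev xs) = list_weight w xs"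
proof (induction xs rule: induct_list012)
  case (3 x y xs)
  then show ?case by (simp add: list_weight_snoc assms[of y x])
qed auto

lemma sum_list_weight_eq_path_weight:
  assumes "finite B" "y \<in> B"
  shows "(\<Sum>vs\<in>{vs. length vs = Suc l \<and> distinct vs \<and> set vs \<subseteq> B \<and> hd vs = y}. list_weight w vs)
     = path_weight w l B y"
  using assms
proof (induction l arbitrary: B y)
  case 0
  then have "{vs. length vs = Suc 0 \<and> distinct vs \<and> set vs \<subseteq> B \<and> hd vs = y} = {[y]}"
    by (auto simp: length_Suc_conv)
  then show ?case by simp
next
  case (Suc l)
  let ?L = "\<lambda>l B y. {vs. length vs = Suc l \<and> distinct vs \<and> set vs \<subseteq> B \<and> hd vs = y}"
  have fin: "finite (?L l (B - {y}) z)" for z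
    by (rule finite_subset[OF _ finite_lists_length_eq[of "B - {y}" "Suc l"]]) (use Suc.prems in auto)
  have "?L (Suc l) B y = (\<lambda>(z, vs). y # vs) ` (SIGMA z:B - {y}. ?L l (B - {y}) z)" (is "?A = ?B")
  proof (intro equalityI subsetI)
    fix vs assume vs: "vs \<in> ?A"
    then obtain ws where ws: "vs = y # ws" "length ws = Suc l" by (cases vs) auto
    then have "hd ws \<in> set ws" by (cases ws) auto
    then have "(hd ws, ws) \<in> (SIGMA z:B - {y}. ?L l (B - {y}) z)" using vs ws by auto
    then show "vs \<in> ?B" using ws(1) by (intro image_eqI[of _ _ "(hd ws, ws)"]) auto
  qed (use Suc.prems in auto)
  then have "(\<Sum>vs\<in>?L (Suc l) B y. list_weight w vs) =
      (\<Sum>p\<in>(SIGMA z:B - {y}. ?L l (B - {y}) z). list_weight w (y # snd p))"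
    by (simp only:, subst sum.reindex) (auto simp: inj_on_def case_prod_beta)
  also have "\<dots> = (\<Sum>z\<in>B - {y}. \<Sum>vs\<in>?L l (B - {y}) z. list_weight w (y # vs))"
    using Suc.prems fin by (subst sum.Sigma) (auto simp: case_prod_beta)
  also have "\<dots> = (\<Sum>z\<in>B - {y}. \<Sum>vs\<in>?L l (B - {y}) z. w y z * list_weight w vs)"
  proof (intro sum.cong refl)
    fix z vs assume "vs \<in> ?L l (B - {y}) z"
    then show "list_weight w (y # vs) = w y z * list_weight w vs" by (cases vs) auto
  qed
  also have "\<dots> = (\<Sum>z\<in>B - {y}. w y z * path_weight w l (B - {y}) z)"
    using Suc by (intro sum.cong refl) (simp flip: sum_distrib_left)
  finally show ?case by simp
qed

text \<open>Since \<open>2 d(v\<^sub>1) d(v\<^sub>m) \<le> d(v\<^sub>1)\<^sup>2 + d(v\<^sub>m)\<^sup>2\<close> and reversal exchanges the two ends, it suffices to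
  weight the paths by the squared degree of their first vertex.\<close>

lemma sum_list_weight_ends_le:
  assumes fin: "finite B" and sym: "\<And>u v. w u v = w v u" and nonneg: "\<And>u v. w u v \<ge> 0" and "m \<ge> 1"
  shows "(\<Sum>vs\<in>{vs. length vs = m \<and> distinct vs \<and> set vs \<subseteq> B}. d (hd vs) * list_weight w vs * d (last vs))
     \<le> (\<Sum>y\<in>B. (d y)\<^sup>2 * path_weight w (m - 1) B y)"
proof -
  let ?L = "{vs. length vs = m \<and> distinct vs \<and> set vs \<subseteq> B}"
  let ?f = "\<lambda>vs. (d (hd vs))\<^sup>2 * list_weight w vs" and ?g = "\<lambda>vs. (d (last vs))\<^sup>2 * list_weight w vs"
  have finL: "finite ?L"
    by (rule finite_subset[OF _ finite_lists_length_eq[OF fin, of m]]) auto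
  have ne: "vs \<noteq> []" if "vs \<in> ?L" for vs using that \<open>m \<ge> 1\<close> by auto
  have "(\<Sum>vs\<in>?L. d (hd vs) * list_weight w vs * d (last vs)) \<le> (\<Sum>vs\<in>?L. (?f vs + ?g vs) / 2)"
  proof (rule sum_mono)
    fix vs
    have "d (hd vs) * d (last vs) \<le> ((d (hd vs))\<^sup>2 + (d (last vs))\<^sup>2) / 2"
      using sum_squares_bound[of "d (hd vs)" "d (last vs)"] by simp
    then have "list_weight w vs * (d (hd vs) * d (last vs)) \<le>
        list_weight w vs * (((d (hd vs))\<^sup>2 + (d (last vs))\<^sup>2) / 2)"
      using list_weight_nonneg[OF nonneg] by (rule mult_left_mono)
    then show "d (hd vs) * list_weight w vs * d (last vs) \<le> (?f vs + ?g vs) / 2"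
      by (simp add: algebra_simps)
  qed
  also have "\<dots> = ((\<Sum>vs\<in>?L. ?f vs) + (\<Sum>vs\<in>?L. ?g vs)) / 2"
    by (simp add: sum.distrib flip: sum_divide_distrib)
  also have "(\<Sum>vs\<in>?L. ?g vs) = (\<Sum>vs\<in>?L. ?f vs)"
    by (rule sum.reindex_bij_witness[of _ rev rev])
      (auto simp: list_weight_rev[OF sym] hd_rev last_rev)
  also have "((\<Sum>vs\<in>?L. ?f vs) + (\<Sum>vs\<in>?L. ?f vs)) / 2 = (\<Sum>vs\<in>?L. ?f vs)" by simp
  also have "\<dots> = (\<Sum>y\<in>B. \<Sum>vs\<in>{vs \<in> ?L. hd vs = y}. ?f vs)"
    using ne by (intro sum.group[symmetric] finL fin) fastforce
  also have "\<dots> = (\<Sum>y\<in>B. (d y)\<^sup>2 * path_weight w (m - 1) B y)"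
  proof (rule sum.cong[OF refl])
    fix y assume "y \<in> B"
    have "(\<Sum>vs\<in>{vs \<in> ?L. hd vs = y}. ?f vs) =
        (d y)\<^sup>2 * (\<Sum>vs\<in>{vs. length vs = Suc (m - 1) \<and> distinct vs \<and> set vs \<subseteq> B \<and> hd vs = y}. list_weight w vs)"
      unfolding sum_distrib_left using \<open>m \<ge> 1\<close> by (intro sum.cong) auto
    then show "(\<Sum>vs\<in>{vs \<in> ?L. hd vs = y}. ?f vs) = (d y)\<^sup>2 * path_weight w (m - 1) B y"
      using sum_list_weight_eq_path_weight[OF fin \<open>y \<in> B\<close>] by simp
  qed
  finally show ?thesis .
qed

section \<open>Counting paths\<close>

text \<open>Paths carry a direction here, so for \<open>k \<ge> 2\<close> each appears twice, which
  is harmless for upper bounds.\<close>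

definition path_lists :: "'a ugraph \<Rightarrow> nat \<Rightarrow> 'a list set" where
  "path_lists G k = {xs. length xs = k \<and> distinct xs \<and> set xs \<subseteq> vertices G \<and>
     successively (\<lambda>u v. {u, v} \<in> edges G) xs}"

lemma finite_path_lists:
  assumes "finite (vertices G)"
  shows "finite (path_lists G k)"
  by (rule finite_subset[OF _ finite_lists_length_eq[OF assms, of k]]) (auto simp: path_lists_def)

lemma num_copies_path_le:
  fixes G :: "'a ugraph"
  assumes "simple_graph G"
  shows "num_copies (path_graph k) G \<le> card (path_lists G k)"
proof -
  let ?h = "\<lambda>xs :: 'a list. (set xs, {{xs ! i, xs ! Suc i} | i. Suc i < k})"
  have "{S. subgraph_of S G \<and> isomorphic (path_graph k) S} \<subseteq> ?h ` path_lists G k"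
  proof
    fix S assume "S \<in> {S. subgraph_of S G \<and> isomorphic (path_graph k) S}"
    then obtain f where sub: "vertices S \<subseteq> vertices G" "edges S \<subseteq> edges G"
      and f: "bij_betw f {..<k} (vertices S)"
      and E: "edges S = (\<lambda>e. f ` e) ` {{i, Suc i} | i. Suc i < k}"
      by (auto simp: subgraph_of_def isomorphic_def path_graph_def)
    define xs where "xs = map f [0..<k]"
    have E': "edges S = {{f i, f (Suc i)} | i. Suc i < k}" unfolding E by (simp add: setcompr_eq_image image_image)
    have set: "set xs = vertices S" using f by (auto simp: xs_def bij_betw_def lessThan_atLeast0)
    have "successively (\<lambda>u v. {u, v} \<in> edges G) xs"
      unfolding successively_conv_nth using E' sub(2) by (auto simp: xs_def)
    moreover have "distinct xs" using f by (auto simp: xs_def distinct_map bij_betw_def lessThan_atLeast0)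
    ultimately have "xs \<in> path_lists G k" using set sub(1) by (simp add: path_lists_def xs_def)
    moreover have "edges S = {{xs ! i, xs ! Suc i} | i. Suc i < k}"
      unfolding E' setcompr_eq_image by (rule image_cong) (auto simp: xs_def)
    then have "S = ?h xs" using set by (simp add: prod_eq_iff)
    ultimately show "S \<in> ?h ` path_lists G k" by blast
  qed
  then have "num_copies (path_graph k) G \<le> card (?h ` path_lists G k)"
    unfolding num_copies_def using assms
    by (intro card_mono finite_imageI finite_path_lists) (auto simp: simple_graph_def)
  also have "\<dots> \<le> card (path_lists G k)"
    using assms by (intro card_image_le finite_path_lists) (auto simp: simple_graph_def)
  finally show ?thesis .
qed

section \<open>List encodings of paths\<close>

primrec paired_lists :: "('a \<times> 'a) set \<Rightarrow> nat \<Rightarrow> 'a list set" where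
  "paired_lists D 0 = {[]}"
| "paired_lists D (Suc j) = (\<lambda>((u, v), xs). u # v # xs) ` (D \<times> paired_lists D j)"

lemma finite_paired_lists: "finite D \<Longrightarrow> finite (paired_lists D j)"
  by (induction j) auto

lemma card_paired_lists_le:
  assumes "finite D"
  shows "card (paired_lists D j) \<le> card D ^ j"
proof (induction j)
  case (Suc j)
  have "card (paired_lists D (Suc j)) \<le> card (D \<times> paired_lists D j)"
    unfolding paired_lists.simps using assms finite_paired_lists by (intro card_image_le) auto
  also have "\<dots> \<le> card D * card D ^ j" using Suc by (simp add: card_cartesian_product)
  finally show ?case by simp
qed simp

text \<open>Only the adjacencies at positions (0,1), (2,3) and so on are kept, so the list costs one
  element of \<open>D\<close> per two vertices.\<close>

lemma successively_in_paired_lists: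
  assumes "successively (\<lambda>u v. (u, v) \<in> D) xs" "length xs = 2 * j"
  shows "xs \<in> paired_lists D j"
  using assms
proof (induction j arbitrary: xs)
  case (Suc j)
  then obtain u v ys where xs: "xs = u # v # ys" "length ys = 2 * j"
    by (cases xs; cases "tl xs") auto
  then have "ys \<in> paired_lists D j" using Suc by (auto simp: successively_Cons)
  moreover have "(u, v) \<in> D" using Suc.prems xs by simp
  ultimately show ?case using xs by (auto intro!: image_eqI[of _ _ "((u, v), ys)"])
qed simp

lemma card_lists_nth_in_le:
  assumes "\<And>i. finite (S i)"
  shows "finite {xs. length xs = k \<and> (\<forall>i<k. xs ! i \<in> S i)} \<and>
    card {xs. length xs = k \<and> (\<forall>i<k. xs ! i \<in> S i)} \<le> (\<Prod>i<k. card (S i))"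
  using assms
proof (induction k arbitrary: S)
  case (Suc k)
  let ?L = "{xs. length xs = k \<and> (\<forall>i<k. xs ! i \<in> S (Suc i))}"
  note IH = Suc.IH[of "\<lambda>i. S (Suc i)", OF Suc.prems]
  have eq: "{xs. length xs = Suc k \<and> (\<forall>i<Suc k. xs ! i \<in> S i)} = (\<lambda>(x, xs). x # xs) ` (S 0 \<times> ?L)"
    by (auto simp: length_Suc_conv image_iff All_less_Suc2)
  have fin: "finite (S 0 \<times> ?L)" using Suc.prems IH by auto
  have "card ((\<lambda>(x, xs). x # xs) ` (S 0 \<times> ?L)) \<le> card (S 0) * card ?L"
    using card_image_le[OF fin] by (simp add: card_cartesian_product)
  also have "\<dots> \<le> (\<Prod>i<Suc k. card (S i))"
    using IH by (simp add: prod.lessThan_Suc_shift mult_left_mono del: prod.lessThan_Suc)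
  finally show ?case unfolding eq using fin by simp
qed simp

lemma prod_odd_even:
  fixes f :: "nat \<Rightarrow> nat"
  shows "(\<Prod>i<2 * m + 1. f i) = (\<Prod>j<m. f (2 * j + 1)) * (\<Prod>j\<le>m. f (2 * j))"
  by (induction m) (auto simp: algebra_simps)

text \<open>These are the ways to insert after each entry of the list an element of \<open>X\<close>
  adjacent to its neighbours in the result, including one after the last entry. The initial vertex
  of a path is added separately; repetitions are allowed.\<close>

fun fillings :: "'a set \<Rightarrow> ('a \<Rightarrow> 'a \<Rightarrow> bool) \<Rightarrow> 'a list \<Rightarrow> 'a list set" where
  "fillings X adj (u # v # vs) =
     (\<lambda>(x, t). u # x # t) ` ({x \<in> X. adj x u \<and> adj x v} \<times> fillings X adj (v # vs))"
| "fillings X adj [u] = (\<lambda>x. [u, x]) ` {x \<in> X. adj x u}"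
| "fillings X adj [] = {}"

lemma card_fillings_le:
  assumes "finite X" "vs \<noteq> []"
  shows "finite (fillings X adj vs) \<and> real (card (fillings X adj vs)) \<le>
    list_weight (\<lambda>u v. real (card {x \<in> X. adj x u \<and> adj x v})) vs * real (card {x \<in> X. adj x (last vs)})"
  using \<open>vs \<noteq> []\<close>
proof (induction vs rule: induct_list012)
  case (2 u)
  have "card ((\<lambda>x. [u, x]) ` {x \<in> X. adj x u}) \<le> card {x \<in> X. adj x u}"
    using assms by (intro card_image_le) auto
  then show ?case using assms by simp
next
  case (3 u v vs)
  let ?A = "{x \<in> X. adj x u \<and> adj x v}" and ?F = "fillings X adj (v # vs)"
  have fin: "finite (?A \<times> ?F)" using 3 assms by auto
  have "card (fillings X adj (u # v # vs)) \<le> card (?A \<times> ?F)"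
    unfolding fillings.simps using fin by (rule card_image_le)
  then have "real (card (fillings X adj (u # v # vs))) \<le> real (card ?A) * real (card ?F)"
    unfolding card_cartesian_product by (metis of_nat_le_iff of_nat_mult)
  also have "\<dots> \<le> real (card ?A) * (list_weight (\<lambda>u v. real (card {x \<in> X. adj x u \<and> adj x v})) (v # vs)
      * real (card {x \<in> X. adj x (last (v # vs))}))"
    using 3 by (intro mult_left_mono) auto
  finally show ?case using fin by (simp add: mult.assoc)
qed simp

text \<open>The witness is the sublist of \<open>t\<close> at even positions. Its inclusion in
  \<open>set t\<close> carries distinctness through the induction.\<close>

lemma alternating_in_fillings:
  assumes "length t = 2 * Suc l" "successively adj t" "distinct t"
    "\<forall>i<Suc l. t ! (2 * i) \<in> B \<and> t ! (2 * i + 1) \<in> X" and sym: "\<And>u v. adj u v = adj v u"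
  shows "\<exists>vs. length vs = Suc l \<and> distinct vs \<and> set vs \<subseteq> B \<inter> set t \<and> hd vs = hd t \<and> t \<in> fillings X adj vs"
  using assms(1-4)
proof (induction l arbitrary: t)
  case 0
  then obtain u x where t: "t = [u, x]" by (cases t; cases "tl t") auto
  with 0 show ?case by (intro exI[of _ "[u]"]) (auto simp: sym)
next
  case (Suc l)
  then obtain u x s where t: "t = u # x # s" "length s = 2 * Suc l"
    by (cases t; cases "tl t") auto
  then obtain v s' where s: "s = v # s'" by (cases s) auto
  have "\<forall>i<Suc l. s ! (2 * i) \<in> B \<and> s ! (2 * i + 1) \<in> X"
  proof (intro allI impI)
    fix i assume "i < Suc l"
    then show "s ! (2 * i) \<in> B \<and> s ! (2 * i + 1) \<in> X"
      using Suc.prems(4)[rule_format, of "Suc i"] t by simp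
  qed
  then obtain vs where vs: "length vs = Suc l" "distinct vs" "set vs \<subseteq> B \<inter> set s" "hd vs = hd s"
      "s \<in> fillings X adj vs"
    using Suc.IH[of s] Suc.prems t by (auto simp: successively_Cons)
  obtain ws where ws: "vs = v # ws" using vs s by (cases vs) auto
  have "u \<in> B" "x \<in> X" using Suc.prems(4)[rule_format, of 0] t by auto
  moreover have "adj u x" "adj x v" using Suc.prems(2) t s by auto
  ultimately have "t \<in> fillings X adj (u # vs)" using vs(5) t unfolding ws by (force simp: sym)
  then show ?case
    using vs t Suc.prems(3) \<open>u \<in> B\<close> by (intro exI[of _ "u # vs"]) auto
qed

text \<open>Around position \<open>2 * j\<close> the path splits into lists of even length, paired
  into \<open>m\<close> elements of \<open>D\<close> in all. The vertex between them is a neighbour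
  of the small vertex that heads the second list, so it has at most \<open>d\<close>
  choices.\<close>

lemma card_paths_small_odd_le:
  fixes G :: "'a ugraph"
  assumes G: "simple_graph G" and small: "\<And>u. u \<in> vertices G - B \<Longrightarrow> card {v. {u, v} \<in> edges G} \<le> d"
  defines "D \<equiv> {(u, v). {u, v} \<in> edges G}"
  shows "card {xs \<in> path_lists G (2 * m + 1). \<exists>j<m. xs ! (2 * j + 1) \<notin> B} \<le> m * (card D ^ m * d)"
proof -
  let ?P = "paired_lists D"
  have D: "D \<subseteq> vertices G \<times> vertices G" and finV: "finite (vertices G)"
    using G by (auto simp: D_def simple_graph_def)
  then have finD: "finite D" by (meson finite_SigmaI finite_subset)
  define W where "W j = {ws \<in> ?P j. ws \<noteq> [] \<and> hd ws \<in> vertices G - B}" for j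
  define S where "S j = (SIGMA p:?P j \<times> W (m - j). {z. {hd (snd p), z} \<in> edges G})" for j
  let ?g = "\<lambda>((ys, ws), z). ys @ z # ws"
  have finW: "finite (?P j \<times> W k)" for j k using finite_paired_lists[OF finD] by (simp add: W_def)
  have fin: "finite {z. {u, z} \<in> edges G}" for u
    by (rule finite_subset[of _ "vertices G"]) (use G in \<open>auto simp: simple_graph_def\<close>)
  have "{xs \<in> path_lists G (2 * m + 1). \<exists>j<m. xs ! (2 * j + 1) \<notin> B} \<subseteq> (\<Union>j<m. ?g ` S j)"
  proof
    fix xs assume "xs \<in> {xs \<in> path_lists G (2 * m + 1). \<exists>j<m. xs ! (2 * j + 1) \<notin> B}"
    then obtain j where xs: "length xs = 2 * m + 1" "set xs \<subseteq> vertices G"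
      and adj: "successively (\<lambda>u v. (u, v) \<in> D) xs" and j: "j < m" "xs ! (2 * j + 1) \<notin> B"
      by (auto simp: path_lists_def D_def)
    define ys ws where "ys = take (2 * j) xs" and "ws = drop (2 * j + 1) xs"
    have split: "xs = ys @ xs ! (2 * j) # ws"
      using xs j by (simp add: ys_def ws_def id_take_nth_drop)
    have len: "length ys = 2 * j" "length ws = 2 * (m - j)" using xs j by (auto simp: ys_def ws_def)
    have ws: "ws \<noteq> []" "hd ws = xs ! (2 * j + 1)" using xs j by (auto simp: ws_def hd_drop_conv_nth)
    have adj': "successively (\<lambda>u v. (u, v) \<in> D) (ys @ xs ! (2 * j) # ws)" using adj split by simp
    then have "successively (\<lambda>u v. (u, v) \<in> D) ys" "successively (\<lambda>u v. (u, v) \<in> D) ws"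
      and z: "(xs ! (2 * j), hd ws) \<in> D"
      using ws by (auto simp: successively_append_iff successively_Cons)
    then have "ys \<in> ?P j" "ws \<in> ?P (m - j)" using len by (auto intro: successively_in_paired_lists)
    moreover have "hd ws \<in> vertices G - B" using ws xs j by (auto simp: subset_iff)
    ultimately have "((ys, ws), xs ! (2 * j)) \<in> S j"
      using z ws by (auto simp: S_def W_def D_def insert_commute)
    then have "?g ((ys, ws), xs ! (2 * j)) \<in> ?g ` S j" by (rule imageI)
    moreover have "?g ((ys, ws), xs ! (2 * j)) = xs" using split by simp
    ultimately show "xs \<in> (\<Union>j<m. ?g ` S j)" using j(1) by (metis UN_I lessThan_iff)
  qed
  then have "card {xs \<in> path_lists G (2 * m + 1). \<exists>j<m. xs ! (2 * j + 1) \<notin> B} \<le> card (\<Union>j<m. ?g ` S j)"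
    using finW fin by (intro card_mono) (auto simp: S_def)
  also have "\<dots> \<le> (\<Sum>j<m. card (?g ` S j))" by (rule card_UN_le) auto
  also have "\<dots> \<le> (\<Sum>j<m. card D ^ m * d)"
  proof (rule sum_mono)
    fix j assume "j \<in> {..<m}"
    have "card (?g ` S j) \<le> card (S j)"
      using finW fin by (intro card_image_le) (auto simp: S_def)
    also have "\<dots> = (\<Sum>p\<in>?P j \<times> W (m - j). card {z. {hd (snd p), z} \<in> edges G})"
      unfolding S_def using finW fin by (intro card_SigmaI) auto
    also have "\<dots> \<le> (\<Sum>p\<in>?P j \<times> W (m - j). d)"
      by (rule sum_mono) (auto simp: W_def intro!: small)
    also have "\<dots> = card (?P j) * card (W (m - j)) * d" by (simp add: card_cartesian_product)
    also have "\<dots> \<le> card D ^ j * card D ^ (m - j) * d"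
    proof (intro mult_right_mono mult_mono)
      have "card (W (m - j)) \<le> card (?P (m - j))"
        unfolding W_def using finite_paired_lists[OF finD] by (intro card_mono) auto
      then show "card (W (m - j)) \<le> card D ^ (m - j)"
        using card_paired_lists_le[OF finD] le_trans by blast
    qed (use card_paired_lists_le[OF finD] in auto)
    also have "\<dots> = card D ^ m * d" using \<open>j \<in> {..<m}\<close> by (simp flip: power_add)
    finally show "card (?g ` S j) \<le> card D ^ m * d" .
  qed
  finally show ?thesis by simp
qed

text \<open>Adjacency is ignored: the \<open>m\<close> odd positions range over \<open>B\<close>,
  one of the \<open>m + 1\<close> even positions over \<open>X\<close>, and the rest over all
  vertices.\<close>

lemma card_paths_exceptional_even_le:
  fixes G :: "'a ugraph"
  assumes fin: "finite (vertices G)" and "B \<subseteq> vertices G" "X \<subseteq> vertices G"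
  shows "card {xs \<in> path_lists G (2 * m + 1). (\<forall>j<m. xs ! (2 * j + 1) \<in> B) \<and> (\<exists>j\<le>m. xs ! (2 * j) \<in> X)}
    \<le> (m + 1) * (card B ^ m * (card X * card (vertices G) ^ m))"
proof -
  let ?V = "vertices G"
  define S where "S j i = (if i = 2 * j then X else if odd i then B else ?V)" for j i :: nat
  define L where "L j = {xs. length xs = 2 * m + 1 \<and> (\<forall>i<2 * m + 1. xs ! i \<in> S j i)}" for j
  have finS: "finite (S j i)" for i j
    using assms by (auto simp: S_def intro: finite_subset)
  note L = card_lists_nth_in_le[of "S j" "2 * m + 1" for j, OF finS, folded L_def]
  have "{xs \<in> path_lists G (2 * m + 1). (\<forall>j<m. xs ! (2 * j + 1) \<in> B) \<and> (\<exists>j\<le>m. xs ! (2 * j) \<in> X)}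
     \<subseteq> (\<Union>j\<le>m. L j)"
  proof
    fix xs assume "xs \<in> {xs \<in> path_lists G (2 * m + 1). (\<forall>j<m. xs ! (2 * j + 1) \<in> B) \<and> (\<exists>j\<le>m. xs ! (2 * j) \<in> X)}"
    then obtain j where xs: "length xs = 2 * m + 1" "set xs \<subseteq> ?V" "\<forall>j<m. xs ! (2 * j + 1) \<in> B"
      and j: "j \<le> m" "xs ! (2 * j) \<in> X" by (auto simp: path_lists_def)
    have "xs ! i \<in> S j i" if "i < 2 * m + 1" for i
    proof (cases "odd i")
      case True
      then obtain k where "i = 2 * k + 1" by (auto elim: oddE)
      moreover have "2 * k + 1 \<noteq> 2 * j" by presburger
      ultimately show ?thesis using that xs by (simp add: S_def)
    next
      case False
      then show ?thesis using that xs j by (auto simp: S_def subset_iff)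
    qed
    then show "xs \<in> (\<Union>j\<le>m. L j)" using xs j by (auto simp: L_def)
  qed
  then have "card {xs \<in> path_lists G (2 * m + 1). (\<forall>j<m. xs ! (2 * j + 1) \<in> B) \<and> (\<exists>j\<le>m. xs ! (2 * j) \<in> X)}
     \<le> card (\<Union>j\<le>m. L j)"
    using L by (intro card_mono) auto
  also have "\<dots> \<le> (\<Sum>j\<le>m. card (L j))" by (rule card_UN_le) auto
  also have "\<dots> \<le> (\<Sum>j\<le>m. card B ^ m * (card X * card ?V ^ m))"
  proof (rule sum_mono)
    fix j assume j: "j \<in> {..m}"
    have "(\<Prod>k\<le>m. card (S j (2 * k))) = card (S j (2 * j)) * (\<Prod>k\<in>{..m} - {j}. card (S j (2 * k)))"
      using j by (intro prod.remove) auto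
    also have "(\<Prod>k\<in>{..m} - {j}. card (S j (2 * k))) = (\<Prod>k\<in>{..m} - {j}. card ?V)"
      by (intro prod.cong) (auto simp: S_def)
    finally have "(\<Prod>k\<le>m. card (S j (2 * k))) = card X * card ?V ^ m"
      using j by (simp add: S_def)
    moreover have "S j (2 * k + 1) = B" for k
    proof -
      have "2 * k + 1 \<noteq> 2 * j" by presburger
      then show ?thesis by (simp add: S_def)
    qed
    ultimately have "(\<Prod>i<2 * m + 1. card (S j i)) = card B ^ m * (card X * card ?V ^ m)"
      unfolding prod_odd_even by simp
    then show "card (L j) \<le> card B ^ m * (card X * card ?V ^ m)" using L[of j] by simp
  qed
  finally show ?thesis by simp
qed

text \<open>Such a path is its list \<open>vs\<close> of odd entries, a first vertex adjacent to
  \<open>hd vs\<close>, and a filling of \<open>vs\<close>. Counting these choices gives exactly the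
  weighted sum bounded by \<open>sum_list_weight_ends_le\<close> and
  \<open>sum_degree_path_weight_le\<close>.\<close>

lemma card_paths_alternating_le:
  fixes G :: "'a ugraph"
  assumes fin: "finite (vertices G)" and "B \<subseteq> vertices G" "X \<subseteq> vertices G" and m: "m \<ge> 2"
    and two: "\<And>x. x \<in> X \<Longrightarrow> card {u \<in> B. {x, u} \<in> edges G} \<le> 2"
  shows "real (card {xs \<in> path_lists G (2 * m + 1). (\<forall>j<m. xs ! (2 * j + 1) \<in> B) \<and> (\<forall>j\<le>m. xs ! (2 * j) \<in> X)})
    \<le> 8 * real (card X) * (real (card X) / real m) ^ m"
proof -
  let ?P = "{xs \<in> path_lists G (2 * m + 1). (\<forall>j<m. xs ! (2 * j + 1) \<in> B) \<and> (\<forall>j\<le>m. xs ! (2 * j) \<in> X)}"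
  define adj where "adj u v \<longleftrightarrow> {u, v} \<in> edges G" for u v
  define a :: "'a \<Rightarrow> 'a \<Rightarrow> real" where "a x u = of_bool (adj x u)" for x u
  define c where "c u v = (\<Sum>x\<in>X. a x u * a x v)" for u v
  define d where "d u = (\<Sum>x\<in>X. a x u)" for u
  have finX: "finite X" and finB: "finite B" using assms finite_subset by blast+
  have sym: "adj u v = adj v u" for u v by (simp add: adj_def insert_commute)
  have c: "c u v = real (card {x \<in> X. adj x u \<and> adj x v})" for u v
    using finX by (simp add: c_def a_def Int_def flip: of_bool_conj)
  have d: "d u = real (card {x \<in> X. adj x u})" for u
    using finX by (simp add: d_def a_def Int_def)
  let ?L = "{vs. length vs = m \<and> distinct vs \<and> set vs \<subseteq> B}"
  let ?S = "SIGMA vs:?L. {x \<in> X. adj x (hd vs)} \<times> fillings X adj vs"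
  let ?g = "\<lambda>(vs :: 'a list, x, t). x # t"
  have finL: "finite ?L"
    by (rule finite_subset[OF _ finite_lists_length_eq[OF finB, of m]]) auto
  have ne: "vs \<noteq> []" if "vs \<in> ?L" for vs using that m by auto
  have fill: "finite (fillings X adj vs)"
    "real (card (fillings X adj vs)) \<le> list_weight c vs * d (last vs)" if "vs \<in> ?L" for vs
    using card_fillings_le[OF finX ne[OF that], of adj] by (simp_all flip: c d)
  have "?P \<subseteq> ?g ` ?S"
  proof
    fix xs assume "xs \<in> ?P"
    then have xs: "length xs = 2 * m + 1" "distinct xs" "successively adj xs"
      "\<forall>j<m. xs ! (2 * j + 1) \<in> B" "\<forall>j\<le>m. xs ! (2 * j) \<in> X"
      by (auto simp: path_lists_def adj_def)
    then obtain x t where t: "xs = x # t" by (cases xs) auto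
    obtain l where l: "m = Suc l" using m by (cases m) auto
    have "\<forall>i<Suc l. t ! (2 * i) \<in> B \<and> t ! (2 * i + 1) \<in> X"
    proof (intro allI impI)
      fix i assume "i < Suc l"
      then show "t ! (2 * i) \<in> B \<and> t ! (2 * i + 1) \<in> X"
        using xs(4)[rule_format, of i] xs(5)[rule_format, of "Suc i"] t l by simp
    qed
    moreover have "length t = 2 * Suc l" "distinct t" "successively adj t" "t \<noteq> []"
      using xs t l by (auto simp: successively_Cons)
    ultimately obtain vs where vs: "length vs = Suc l" "distinct vs" "set vs \<subseteq> B \<inter> set t"
        "hd vs = hd t" "t \<in> fillings X adj vs"
      using alternating_in_fillings[of t l adj B X] sym by blast
    have "adj x (hd vs)" using xs(3) t vs(4) \<open>t \<noteq> []\<close> by (simp add: successively_Cons)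
    moreover have "x \<in> X" using xs(5)[rule_format, of 0] t by simp
    ultimately have "(vs, x, t) \<in> ?S" using vs l by auto
    then have "?g (vs, x, t) \<in> ?g ` ?S" by (rule imageI)
    then show "xs \<in> ?g ` ?S" using t by simp
  qed
  moreover have finS: "finite ?S" using finL fill(1) finX by (intro finite_SigmaI) auto
  ultimately have "card ?P \<le> card (?g ` ?S)" by (intro card_mono finite_imageI)
  also have "\<dots> \<le> card ?S" using finS by (rule card_image_le)
  also have "\<dots> = (\<Sum>vs\<in>?L. card ({x \<in> X. adj x (hd vs)} \<times> fillings X adj vs))"
    using finL fill(1) finX by (intro card_SigmaI) auto
  finally have "real (card ?P) \<le> real (\<Sum>vs\<in>?L. card ({x \<in> X. adj x (hd vs)} \<times> fillings X adj vs))"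
    by (rule of_nat_mono)
  also have "\<dots> = (\<Sum>vs\<in>?L. d (hd vs) * real (card (fillings X adj vs)))"
    by (simp add: card_cartesian_product d)
  also have "\<dots> \<le> (\<Sum>vs\<in>?L. d (hd vs) * (list_weight c vs * d (last vs)))"
  proof (intro sum_mono mult_left_mono fill(2))
    show "0 \<le> d u" for u by (simp add: d)
  qed
  also have "\<dots> \<le> (\<Sum>y\<in>B. (d y)\<^sup>2 * path_weight c (m - 1) B y)"
    using sum_list_weight_ends_le[OF finB, of c m d] m by (simp add: c mult.assoc conj_commute)
  also have "\<dots> \<le> 8 * real (card X) * (real (card X) / real m) ^ m"
    unfolding c_def d_def
  proof (rule sum_degree_path_weight_le[OF finB _ _ m])
    show "a x u = 0 \<or> a x u = 1" for x u by (simp add: a_def)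
    show "(\<Sum>u\<in>B. a x u) \<le> 2" if "x \<in> X" for x
      using two[OF that] finB by (simp add: a_def adj_def Int_def)
  qed
  finally show ?thesis .
qed

text \<open>Each such \<open>x\<close> picks three of its neighbours in \<open>B\<close>. Three
  vertices with the same choice would form a \<open>K33\<close>, so every subset of \<open>B\<close>
  is picked at most twice.\<close>

lemma planar_card_many_neighbours_le:
  fixes G :: "'a ugraph"
  assumes G: "planar_graph G" and B: "B \<subseteq> vertices G"
  shows "card {x \<in> vertices G. card {u \<in> B. {x, u} \<in> edges G} > 2} \<le> 2 * 2 ^ card B"
proof -
  define X where "X = {x \<in> vertices G. card {u \<in> B. {x, u} \<in> edges G} > 2}"
  have simple: "simple_graph G" and finV: "finite (vertices G)"
    using G by (auto simp: planar_graph_def simple_graph_def)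
  have finB: "finite B" and finX: "finite X" using B finV finite_subset by (auto simp: X_def)
  have "\<exists>T\<subseteq>{u \<in> B. {x, u} \<in> edges G}. card T = 3" if "x \<in> X" for x
    using that obtain_subset_with_card_n[of 3 "{u \<in> B. {x, u} \<in> edges G}"] by (force simp: X_def)
  then obtain T where T: "\<And>x. x \<in> X \<Longrightarrow> T x \<subseteq> {u \<in> B. {x, u} \<in> edges G}" "\<And>x. x \<in> X \<Longrightarrow> card (T x) = 3"
    by metis
  have le2: "card {x \<in> X. T x = Y} \<le> 2" for Y
  proof (rule ccontr)
    assume "\<not> card {x \<in> X. T x = Y} \<le> 2"
    then have "3 \<le> card {x \<in> X. T x = Y}" by simp
    then obtain A where A: "A \<subseteq> {x \<in> X. T x = Y}" "card A = 3" using obtain_subset_with_card_n by metis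
    then have adj: "{x, u} \<in> edges G" if "x \<in> A" "u \<in> Y" for x u using that T(1)[of x] by blast
    obtain x where "x \<in> A" using A by fastforce
    then have "Y \<subseteq> vertices G" "card Y = 3" using A T[of x] B by auto
    moreover have "A \<inter> Y = {}"
    proof (rule ccontr)
      assume "A \<inter> Y \<noteq> {}"
      then obtain u where "{u, u} \<in> edges G" using adj by blast
      then show False using simple by (auto simp: simple_graph_def)
    qed
    moreover have "A \<subseteq> vertices G" using A by (auto simp: X_def)
    ultimately show False using planar_no_K33[OF G, of A Y] A adj by blast
  qed
  have "X = (\<Union>Y\<in>Pow B. {x \<in> X. T x = Y})" using T(1) by blast
  then have "card X \<le> (\<Sum>Y\<in>Pow B. card {x \<in> X. T x = Y})"
    using card_UN_le[of "Pow B" "\<lambda>Y. {x \<in> X. T x = Y}"] finB by simp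
  also have "\<dots> \<le> (\<Sum>Y\<in>Pow B. 2)" using le2 by (rule sum_mono)
  also have "\<dots> = 2 * 2 ^ card B" using finB by (simp add: card_Pow)
  finally show ?thesis by (simp add: X_def)
qed

section \<open>Degree sums and the bound for a single planar graph\<close>

lemma card_darts:
  assumes "simple_graph G"
  shows "card {(u, v). {u, v} \<in> edges G} = 2 * card (edges G)"
    and "(\<Sum>u\<in>vertices G. card {v. {u, v} \<in> edges G}) = 2 * card (edges G)"
proof -
  have G: "finite (vertices G)" "\<And>e. e \<in> edges G \<Longrightarrow> card e = 2" "edges G \<subseteq> Pow (vertices G)"
    using assms by (auto simp: simple_graph_def)
  have finE: "finite (edges G)" using finite_subset[OF G(3)] G(1) by simp
  have nb: "{v. {u, v} \<in> edges G} = {v \<in> vertices G. {u, v} \<in> edges G}" for u using G by auto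
  have "(\<Sum>u\<in>vertices G. card {v. {u, v} \<in> edges G}) =
      (\<Sum>u\<in>vertices G. card {e \<in> edges G. e \<subseteq> vertices G \<and> u \<in> e})"
    unfolding nb using card_incident_edges[of "edges G"] G(2) by (intro sum.cong) auto
  also have "\<dots> = 2 * card {e \<in> edges G. e \<subseteq> vertices G}"
    using G(1) finE G(2) by (rule sum_card_incident_edges)
  also have "{e \<in> edges G. e \<subseteq> vertices G} = edges G" using G by auto
  finally show sum: "(\<Sum>u\<in>vertices G. card {v. {u, v} \<in> edges G}) = 2 * card (edges G)" .
  have "{(u, v). {u, v} \<in> edges G} = (SIGMA u:vertices G. {v. {u, v} \<in> edges G})"
    using G by auto
  then have "card {(u, v). {u, v} \<in> edges G} = (\<Sum>u\<in>vertices G. card {v. {u, v} \<in> edges G})"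
    using G(1) nb by simp
  then show "card {(u, v). {u, v} \<in> edges G} = 2 * card (edges G)" using sum by simp
qed

text \<open>The three terms bound the paths with a small vertex at an odd position, those with all
  odd positions big and an exceptional even one, and the remaining ones.\<close>

lemma planar_num_paths_le:
  fixes G :: "'a ugraph"
  assumes G: "planar_graph G" and n: "card (vertices G) = n" "n > 0" and m: "m \<ge> 2" and q: "q > 0"
  defines "b \<equiv> q * 6144"
  shows "real (num_copies (path_graph (2 * m + 1)) G) \<le>
    real m * (6144 * real n) ^ m * (real n / real q) +
    real ((m + 1) * (b ^ m * (2 * 2 ^ b))) * real n ^ m + 8 * real n * (real n / real m) ^ m"
proof -
  have simple: "simple_graph G" and finV: "finite (vertices G)"
    using G by (auto simp: planar_graph_def simple_graph_def)
  let ?deg = "\<lambda>u. card {v. {u, v} \<in> edges G}"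
  define B where "B = {u \<in> vertices G. n < q * ?deg u}"
  define X where "X = {x \<in> vertices G. card {u \<in> B. {x, u} \<in> edges G} > 2}"
  let ?P = "path_lists G (2 * m + 1)"
  define P1 where "P1 = {xs \<in> ?P. \<exists>j<m. xs ! (2 * j + 1) \<notin> B}"
  define P2 where "P2 = {xs \<in> ?P. (\<forall>j<m. xs ! (2 * j + 1) \<in> B) \<and> (\<exists>j\<le>m. xs ! (2 * j) \<in> X)}"
  define P3 where "P3 = {xs \<in> ?P. (\<forall>j<m. xs ! (2 * j + 1) \<in> B) \<and> (\<forall>j\<le>m. xs ! (2 * j) \<in> vertices G - X)}"
  have E: "card (edges G) \<le> 3072 * n" using planar_card_edges_le[OF G] n by simp
  have BV: "B \<subseteq> vertices G" "X \<subseteq> vertices G" by (auto simp: B_def X_def)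
  \<comment> \<open>Degrees sum to at most \<open>6144 * n\<close>, twice the edge bound, and every
    big vertex has degree above \<open>n / q\<close>; hence \<open>card B \<le> b\<close>.\<close>
  have "card B * n = (\<Sum>u\<in>B. n)" by simp
  also have "\<dots> \<le> (\<Sum>u\<in>B. q * ?deg u)" by (rule sum_mono) (auto simp: B_def)
  also have "\<dots> \<le> (\<Sum>u\<in>vertices G. q * ?deg u)"
    using finV BV by (intro sum_mono2) auto
  also have "\<dots> = q * (2 * card (edges G))"
    using card_darts(2)[OF simple] by (simp flip: sum_distrib_left)
  also have "\<dots> \<le> b * n" using E by (simp add: b_def)
  finally have cardB: "card B \<le> b" using n by simp
  have "card X \<le> 2 * 2 ^ card B"
    unfolding X_def by (rule planar_card_many_neighbours_le[OF G BV(1)])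
  also have "\<dots> \<le> 2 * 2 ^ b" using cardB by simp
  finally have cardX: "card X \<le> 2 * 2 ^ b" .
  have "?deg u \<le> n div q" if "u \<in> vertices G - B" for u
    using that q by (auto simp: B_def less_eq_div_iff_mult_less_eq mult.commute)
  then have "card P1 \<le> m * (card {(u, v). {u, v} \<in> edges G} ^ m * (n div q))"
    unfolding P1_def by (rule card_paths_small_odd_le[OF simple])
  also have "\<dots> \<le> m * ((6144 * n) ^ m * (n div q))"
    using E unfolding card_darts(1)[OF simple]
    by (intro mult_le_mono1 mult_le_mono2 power_mono) auto
  finally have "real (card P1) \<le> real (m * ((6144 * n) ^ m * (n div q)))" by (rule of_nat_mono)
  also have "\<dots> = real m * (6144 * real n) ^ m * real (n div q)" by simp
  also have "\<dots> \<le> real m * (6144 * real n) ^ m * (real n / real q)"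
    by (intro mult_left_mono of_nat_div_le_of_nat) auto
  finally have P1: "real (card P1) \<le> real m * (6144 * real n) ^ m * (real n / real q)" .
  have "card P2 \<le> (m + 1) * (card B ^ m * (card X * n ^ m))"
    unfolding P2_def n(1)[symmetric] by (rule card_paths_exceptional_even_le[OF finV BV])
  also have "\<dots> \<le> (m + 1) * (b ^ m * (2 * 2 ^ b * n ^ m))"
    using cardB cardX by (intro mult_le_mono power_mono le_refl) auto
  finally have "real (card P2) \<le> real ((m + 1) * (b ^ m * (2 * 2 ^ b * n ^ m)))" by (rule of_nat_mono)
  then have P2: "real (card P2) \<le> real ((m + 1) * (b ^ m * (2 * 2 ^ b))) * real n ^ m"
    by (simp add: algebra_simps)
  have "real (card P3) \<le> 8 * real (card (vertices G - X)) * (real (card (vertices G - X)) / real m) ^ m"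
    unfolding P3_def
    by (rule card_paths_alternating_le[OF finV BV(1) _ m]) (auto simp: X_def not_less)
  also have "\<dots> \<le> 8 * real n * (real n / real m) ^ m"
    using card_mono[OF finV, of "vertices G - X"] n
    by (intro mult_mono power_mono divide_right_mono) auto
  finally have P3: "real (card P3) \<le> 8 * real n * (real n / real m) ^ m" .
  have "?P \<subseteq> P1 \<union> P2 \<union> P3"
  proof
    fix xs assume xs: "xs \<in> ?P"
    then have "xs ! (2 * j) \<in> vertices G" if "j \<le> m" for j
      using that by (auto simp: path_lists_def subset_iff)
    then show "xs \<in> P1 \<union> P2 \<union> P3" using xs unfolding P1_def P2_def P3_def by blast
  qed
  moreover have "finite (P1 \<union> P2 \<union> P3)"
    using finite_path_lists[OF finV] by (auto simp: P1_def P2_def P3_def)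
  ultimately have "card ?P \<le> card (P1 \<union> P2 \<union> P3)" by (intro card_mono)
  also have "\<dots> \<le> card P1 + card P2 + card P3"
    by (meson add_le_mono card_Un_le le_refl le_trans)
  finally have "num_copies (path_graph (2 * m + 1)) G \<le> card P1 + card P2 + card P3"
    using num_copies_path_le[OF simple] le_trans by blast
  then have "real (num_copies (path_graph (2 * m + 1)) G) \<le> real (card P1 + card P2 + card P3)"
    by (rule of_nat_mono)
  then show ?thesis using P1 P2 P3 by simp
qed

theorem theorem1p1:
  shows "\<exists>C :: real. \<forall>m :: nat. m \<ge> 2 \<longrightarrow>
    (\<exists>n0 :: nat. \<forall>n \<ge> n0.
      real (max_planar_copies n (path_graph (2 * m + 1)))
        \<le> C * real m powi (- int m) * real n ^ (m + 1))"
proof (rule exI[of _ 10], intro allI impI)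
  fix m :: nat
  assume m: "m \<ge> 2"
  \<comment> \<open>With this \<open>q\<close> the first term equals \<open>?M\<close> exactly. The
    second is at most \<open>?M\<close> for large \<open>n\<close> and the third is
    \<open>8 * ?M\<close>, which explains the constant 10.\<close>
  define q where "q = m * (6144 * m) ^ m"
  define b where "b = q * 6144"
  define K where "K = (m + 1) * (b ^ m * (2 * 2 ^ b))"
  have q: "q > 0" using m by (simp add: q_def)
  show "\<exists>n0. \<forall>n\<ge>n0. real (max_planar_copies n (path_graph (2 * m + 1)))
        \<le> 10 * real m powi (- int m) * real n ^ (m + 1)"
  \<comment> \<open>\<open>n \<ge> K * m ^ m\<close> absorbs the second term; the extra 1 ensures
    \<open>n > 0\<close>.\<close>
  proof (intro exI[of _ "K * m ^ m + 1"] allI impI)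
    fix n assume n: "n \<ge> K * m ^ m + 1"
    let ?M = "real n ^ (m + 1) / real m ^ m"
    obtain G :: "nat ugraph" where G: "planar_graph G" "card (vertices G) = n"
      and max: "max_planar_copies n (path_graph (2 * m + 1)) = num_copies (path_graph (2 * m + 1)) G"
      using Max_in[OF copy_counts_finite copy_counts_nonempty,
          where n1 = n and H1 = "path_graph (2 * m + 1)"]
      unfolding max_planar_copies_def by blast
    have "real m * (6144 * real n) ^ m * (real n / real q) = ?M"
      using m by (simp add: q_def power_mult_distrib)
    moreover have "real K * real n ^ m \<le> ?M"
    proof -
      have "real (K * m ^ m) \<le> real n" using n by (intro of_nat_mono) simp
      then have "real K * real m ^ m * real n ^ m \<le> real n * real n ^ m"
        by (intro mult_right_mono) auto
      then show ?thesis using m by (simp add: pos_le_divide_eq mult_ac)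
    qed
    moreover have "8 * real n * (real n / real m) ^ m = 8 * ?M" by (simp add: power_divide)
    moreover have "real (num_copies (path_graph (2 * m + 1)) G) \<le>
        real m * (6144 * real n) ^ m * (real n / real q) + real K * real n ^ m
          + 8 * real n * (real n / real m) ^ m"
      unfolding K_def b_def using n by (intro planar_num_paths_le[OF G _ m q]) simp
    ultimately have "real (num_copies (path_graph (2 * m + 1)) G) \<le> 10 * ?M" by linarith
    then show "real (max_planar_copies n (path_graph (2 * m + 1)))
        \<le> 10 * real m powi (- int m) * real n ^ (m + 1)"
      unfolding max by (simp add: power_int_minus field_simps)
  qed
qed

end
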